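(* Assume $d\ge3$ and let $(C_n)$ be positive numbers with $C_n\downarrow0$ and $nC_n\to\infty$. Then, as $n\to\infty$, $$\inf_{\rho\in\mathfrak M_d:\,\chi_*(\rho)\le C_n}\ \inf_{\widehat\theta}\ \sup_{\theta\in\Delta_d}\mathbb E_{\theta,\rho}\|\widehat\theta-\theta\|_2^2=\frac{d-1}{nd}\cdot\frac{d+2\sqrt{d-1}}{C_n}\,(1+o(1)),$$ where the inner infimum is over all estimators. For all sufficiently large $n$, the upper bound is achieved exactly by $\rho_{p_n,\lambda_*}$ with $p_n=C_n/C_*(d)$ together with the canonical estimator $\widehat\theta_\rho=\mathbf 1/d+H\Sigma(\rho)^{-1}\frac1n\sum_mX_m$, whose worst-case risk equals $\frac{d-1}{nd}\cdot\frac{d+2\sqrt{d-1}}{C_n}$.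
   Context: Fix $d\ge3$. Let $H\in\mathbb R^{d\times(d-1)}$ have orthonormal columns spanning $\{u\in\mathbb R^d:\mathbf 1^\top u=0\}$, $\gamma_i:=H^\top e_i$, $\mathcal X_d:=\{x\in\mathbb R^{d-1}:1+\gamma_i^\top x\ge0\ \forall i\}$, $\Delta_d$ the probability simplex, $h_\theta:=\sum_i\theta_i\gamma_i$. An anchored law is a Borel probability measure $\rho$ on $\mathcal X_d$ with $\int x\,\rho(dx)=0$; $\mathfrak M_d$ is the set of anchored laws; $\Sigma(\rho):=\int xx^\top\rho(dx)$. Model: $X_1,\dots,X_n$ i.i.d. with law $q_\theta(dx):=(1+h_\theta^\top x)\rho(dx)$ (the law of a user's privatized output through $W_\rho(B\mid i):=\int_B(1+\gamma_i^\top x)\rho(dx)$ when inputs are i.i.d. $\theta$); an estimator is any measurable map $\widehat\theta:\mathcal X_d^n\to\mathbb R^d$, and $\mathbb E_{\theta,\rho}$ is expectation in this model. Budget: $\chi_*(\rho):=\max_{i\ne j}\int\frac{((\gamma_j-\gamma_i)^\top x)^2}{1+\gamma_i^\top x}\rho(dx)$ (integrand $0$ where $1+\gamma_i^\top x=0=(\gamma_j-\gamma_i)^\top x$, $+\infty$ where $1+\gamma_i^\top x=0\ne(\gamma_j-\gamma_i)^\top x$). For $\lambda>1$, $p\in[0,1]$: $t_\lambda:=\frac{d(\lambda-1)}{d+\lambda-1}$, $\rho_{p,\lambda}:=(1-p)\delta_0+\frac pd\sum_i\delta_{t_\lambda\gamma_i}$; $\lambda_*:=\sqrt{d-1}$,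 $C_*(d):=\frac{(\lambda_*-1)^2(\lambda_*+1)}{\lambda_*(d+\lambda_*-1)}$. *)

theory Defs
  imports "HOL-Probability.Probability"
begin

text \<open>Dimension d = CARD('d); the reduced space R^(d-1) is real^'m with CARD('m) = d - 1.
  H :: real^'m^'d is a d x (d-1) matrix.\<close>

definition gam :: "real^'m^'d \<Rightarrow> 'd \<Rightarrow> real^'m" where
  "gam H i = transpose H *v axis i 1"

definition Xd :: "real^'m^'d \<Rightarrow> (real^'m) set" where
  "Xd H = {x. \<forall>i. 0 \<le> 1 + gam H i \<bullet> x}"

definition prob_simplex :: "(real^'d) set" where
  "prob_simplex = {\<theta>. (\<forall>i. 0 \<le> \<theta> $ i) \<and> (\<Sum>i\<in>UNIV. \<theta> $ i) = 1}"

definition hth :: "real^'m^'d \<Rightarrow> real^'d \<Rightarrow> real^'m" where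
  "hth H \<theta> = (\<Sum>i\<in>UNIV. \<theta> $ i *\<^sub>R gam H i)"

definition anchored :: "real^'m^'d \<Rightarrow> (real^'m) measure set" where
  "anchored H = {\<rho>. sets \<rho> = sets borel \<and> prob_space \<rho> \<and> (AE x in \<rho>. x \<in> Xd H)
                   \<and> (\<integral>x. x \<partial>\<rho>) = 0}"

definition Sigma_mat :: "(real^'m) measure \<Rightarrow> real^'m^'m" where
  "Sigma_mat \<rho> = (\<chi> k l. \<integral>x. x $ k * x $ l \<partial>\<rho>)"

definition chi_integrand :: "real^'m^'d \<Rightarrow> 'd \<Rightarrow> 'd \<Rightarrow> real^'m \<Rightarrow> ennreal" where
  "chi_integrand H i j x =
     (let a = 1 + gam H i \<bullet> x; b = (gam H j - gam H i) \<bullet> x in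
      if 0 < a then ennreal (b\<^sup>2 / a) else if b = 0 then 0 else \<infinity>)"

definition chi_star :: "real^'m^'d \<Rightarrow> (real^'m) measure \<Rightarrow> ennreal" where
  "chi_star H \<rho> = (SUP ij\<in>{(i, j). i \<noteq> j}. \<integral>\<^sup>+ x. chi_integrand H (fst ij) (snd ij) x \<partial>\<rho>)"

text \<open>Law of one privatized output when inputs are i.i.d. theta.\<close>
definition q_law :: "real^'m^'d \<Rightarrow> real^'d \<Rightarrow> (real^'m) measure \<Rightarrow> (real^'m) measure" where
  "q_law H \<theta> \<rho> = density \<rho> (\<lambda>x. ennreal (1 + hth H \<theta> \<bullet> x))"

definition estimators :: "nat \<Rightarrow> ((nat \<Rightarrow> real^'m) \<Rightarrow> real^'d) set" where
  "estimators n = measurable (PiM {..<n} (\<lambda>_. borel)) borel"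

definition risk :: "real^'m^'d \<Rightarrow> nat \<Rightarrow> (real^'m) measure \<Rightarrow> real^'d
                     \<Rightarrow> ((nat \<Rightarrow> real^'m) \<Rightarrow> real^'d) \<Rightarrow> ennreal" where
  "risk H n \<rho> \<theta> est = (\<integral>\<^sup>+ \<omega>. ennreal ((norm (est \<omega> - \<theta>))\<^sup>2) \<partial>(PiM {..<n} (\<lambda>_. q_law H \<theta> \<rho>)))"

definition worst_risk :: "real^'m^'d \<Rightarrow> nat \<Rightarrow> (real^'m) measure
                     \<Rightarrow> ((nat \<Rightarrow> real^'m) \<Rightarrow> real^'d) \<Rightarrow> ennreal" where
  "worst_risk H n \<rho> est = (SUP \<theta>\<in>prob_simplex. risk H n \<rho> \<theta> est)"

definition minimax :: "real^'m^'d \<Rightarrow> nat \<Rightarrow> real \<Rightarrow> ennreal" where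
  "minimax H n C = (INF \<rho>\<in>{\<rho>\<in>anchored H. chi_star H \<rho> \<le> ennreal C}.
                      INF est\<in>(estimators n :: ((nat \<Rightarrow> real^'m) \<Rightarrow> real^'d) set).
                        worst_risk H n \<rho> est)"

definition t_lam :: "real \<Rightarrow> real \<Rightarrow> real" where
  "t_lam d lam = d * (lam - 1) / (d + lam - 1)"

definition rho_pl :: "real^'m^'d \<Rightarrow> real \<Rightarrow> real \<Rightarrow> (real^'m) measure" where
  "rho_pl H p lam = measure_of UNIV (sets borel)
     (\<lambda>A. ennreal (1 - p) * indicator A 0
          + ennreal (p / real CARD('d)) * (\<Sum>i\<in>UNIV. indicator A (t_lam (real CARD('d)) lam *\<^sub>R gam H i)))"

definition lam_star :: "real \<Rightarrow> real" where
  "lam_star d = sqrt (d - 1)"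

definition C_star :: "real \<Rightarrow> real" where
  "C_star d = (lam_star d - 1)\<^sup>2 * (lam_star d + 1) / (lam_star d * (d + lam_star d - 1))"

definition canon_est :: "real^'m^'d \<Rightarrow> nat \<Rightarrow> (real^'m) measure \<Rightarrow> (nat \<Rightarrow> real^'m) \<Rightarrow> real^'d" where
  "canon_est H n \<rho> \<omega> = (\<chi> i. 1 / real CARD('d))
      + H *v (matrix_inv (Sigma_mat \<rho>) *v ((1 / real n) *\<^sub>R (\<Sum>m<n. \<omega> m)))"

end

theory Submission
  imports Defs
begin

text \<open>Write \<open>u_i = 1 + \<gamma>_i \<bullet> x\<close>. The budget integrand summed over all pairs is
  \<open>\<Sum>_{i,j} (u_j - u_i)^2 / u_i\<close>, which is at least \<open>(d + 2 \<surd>(d - 1)) |x|^2\<close>; hence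
  \<open>\<chi>_* \<le> C\<close> forces \<open>tr \<Sigma> \<le> d (d - 1) C / (d + 2 \<surd>(d - 1))\<close>. In the coordinates
  \<open>h = H\<^sup>T \<theta>\<close>, the Fisher information near \<open>h = 0\<close> is \<open>n \<Sigma>\<close> up to a factor
  \<open>1 / (1 - \<eta>)\<close>, so the van Trees inequality, applied in each coordinate to a product prior on a
  cube of side \<open>2 r\<close>, bounds the risk below by
  \<open>(d - 1)^2 / (n tr \<Sigma> / (1 - \<eta>) + 10 (d - 1) / r^2)\<close>. The choice \<open>r = (n C)^(-1/4)\<close> makes
  both corrections vanish uniformly in \<open>\<rho>\<close>. The mixtures \<open>\<rho>_{p,\<lambda>}\<close> with
  \<open>\<lambda> = \<surd>(d - 1)\<close> attain the second-moment bound with isotropic \<open>\<Sigma> = s I\<close>, and the risk of the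
  canonical estimator is then \<open>((d - 1) / s - |h_\<theta>|^2) / n\<close>, largest at the uniform \<open>\<theta>\<close>.\<close>

section \<open>The simplex frame\<close>

text \<open>Replacing the maximum over pairs by their sum loses nothing at the optimum. In the
  mixtures every pair \<open>(i, j)\<close> has the same integral by symmetry, and every nonzero
  atom is an equality case of the pointwise inequality: there one \<open>u_i\<close> equals sqrt(d -
  1) times the common value of the others. That ratio is where \<open>lam_star\<close> comes from.
  The obstacle in the lower bound is uniformity over \<rho>, whose \<Sigma> may be anisotropic or
  singular. Two choices deal with it. \<open>Xd H\<close> is bounded independently of \<rho>, so |h
  \<bullet> x| is at most d^3 r on the whole cube, whatever \<rho> is. And van Trees is kept in the
  linear form 2 c \<le> risk + c^2 * information, with one c for all coordinates: summation then
  involves only tr \<Sigma>, no inverse of \<Sigma> appears, and nothing is divided in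
  \<open>ennreal\<close>. The exponent -1/4 is a convenient compromise: d^3 r must vanish, while the
  information of the prior, of order 1 / r^2, must stay small against n C.\<close>

lemma gam_nth: "gam H i $ k = H $ i $ k"
  by (simp add: gam_def matrix_vector_mult_basis column_def transpose_def)

lemma inner_gam: "gam H i \<bullet> x = (H *v x) $ i"
  by (simp add: inner_vec_def gam_nth matrix_vector_mult_def)

lemma inner_matrix_vector_transpose:
  fixes H :: "real^'m^'d"
  shows "(H *v x) \<bullet> y = x \<bullet> (transpose H *v y)"
  using dot_lmul_matrix[of y H x] by (simp add: inner_commute)

lemma hth_eq: "hth H \<theta> = transpose H *v \<theta>"
  by (simp add: vec_eq_iff hth_def gam_nth matrix_vector_mult_def transpose_def mult.commute)

locale simplex_frame =
  fixes H :: "real^'m^'d" and dd :: real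
  assumes dd_eq: "dd = real CARD('d)"
    and dim3: "3 \<le> CARD('d)" and dim_m: "CARD('m) = CARD('d) - 1"
    and ortho: "transpose H ** H = mat 1" and ortho_one: "transpose H *v (\<chi> i. 1) = 0"
begin

lemma card_d [simp]: "real CARD('d) = dd"
  by (rule dd_eq[symmetric])

lemma card_m: "real CARD('m) = dd - 1"
  using dim3 dim_m by (simp add: of_nat_diff)

lemma dd3: "3 \<le> dd"
  using dim3 by (simp add: card_d[symmetric] del: card_d)

lemma sum_col: "(\<Sum>i\<in>UNIV. H $ i $ k) = 0"
  using ortho_one by (simp add: vec_eq_iff matrix_vector_mult_def transpose_def)

lemma sum_col_col: "(\<Sum>i\<in>UNIV. H $ i $ k * H $ i $ l) = (if k = l then 1 else 0)"
proof -
  have "(transpose H ** H) $ k $ l = (mat 1 :: real^'m^'m) $ k $ l"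
    using ortho by simp
  then show ?thesis by (simp add: matrix_matrix_mult_def transpose_def mat_def)
qed

text \<open>This is H H^T = I - 1 1^T / d. The error matrix \<open>E\<close> has squared Frobenius
  norm zero, which needs only the trace of \<open>G\<close> = H H^T, its vanishing row sums and its
  Frobenius norm; no completion of the columns to an orthonormal basis is involved.\<close>

lemma sum_row_row: "(\<Sum>k\<in>UNIV. H $ i $ k * H $ j $ k) = (if i = j then 1 else 0) - 1 / dd"
proof -
  define G where "G = (\<lambda>i j. \<Sum>k\<in>UNIV. H $ i $ k * H $ j $ k)"
  define e where "e = (\<lambda>i j :: 'd. if i = j then 1 else 0 :: real)"
  define E where "E = (\<lambda>i j. e i j - G i j - 1 / dd)"
  have tr: "(\<Sum>i\<in>UNIV. G i i) = dd - 1"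
    unfolding G_def by (subst sum.swap) (simp add: sum_col_col card_m)
  have rs: "(\<Sum>j\<in>UNIV. G i j) = 0" for i
    unfolding G_def by (subst sum.swap) (simp add: sum_distrib_left[symmetric] sum_col)
  have "(\<Sum>i\<in>UNIV. \<Sum>j\<in>UNIV. (G i j)\<^sup>2)
      = (\<Sum>i\<in>UNIV. \<Sum>j\<in>UNIV. \<Sum>k\<in>UNIV. \<Sum>l\<in>UNIV. (H $ i $ k * H $ i $ l) * (H $ j $ k * H $ j $ l))"
    unfolding G_def power2_eq_square sum_product by (simp add: mult_ac)
  also have "\<dots> = (\<Sum>i\<in>UNIV. \<Sum>k\<in>UNIV. \<Sum>l\<in>UNIV. \<Sum>j\<in>UNIV. (H $ i $ k * H $ i $ l) * (H $ j $ k * H $ j $ l))"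
    by (intro sum.cong refl, subst sum.swap, intro sum.cong refl, subst sum.swap, simp)
  also have "\<dots> = (\<Sum>i\<in>UNIV. G i i)"
    by (simp add: sum_distrib_left[symmetric] sum_col_col G_def if_distrib cong: if_cong)
  finally have GG: "(\<Sum>i\<in>UNIV. \<Sum>j\<in>UNIV. (G i j)\<^sup>2) = dd - 1"
    by (simp add: tr)
  define b where "b = 2 / dd"
  define c where "c = 1 / dd\<^sup>2"
  have sq: "(E i j)\<^sup>2 = e i j + (G i j)\<^sup>2 + c - 2 * (e i j * G i j) - b * e i j + b * G i j" for i j
    by (auto simp: E_def e_def b_def c_def power2_eq_square algebra_simps)
  have eG: "(\<Sum>j\<in>UNIV. e i j * G i j) = G i i" "(\<Sum>j\<in>UNIV. e i j) = 1" for i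
    by (simp_all add: e_def if_distrib[where f = "\<lambda>z. z * _"] cong: if_cong)
  have "(\<Sum>i\<in>UNIV. \<Sum>j\<in>UNIV. (E i j)\<^sup>2)
      = dd + (dd - 1) + dd * dd * c - 2 * (dd - 1) - b * dd"
    by (simp add: sq sum.distrib sum_subtractf sum_distrib_left[symmetric] GG rs eG tr)
  also have "\<dots> = 0"
    using dd3 by (simp add: b_def c_def power2_eq_square)
  finally have "(\<Sum>i\<in>UNIV. \<Sum>j\<in>UNIV. (E i j)\<^sup>2) = 0" .
  then have "E i j = 0"
    by (simp add: sum_nonneg_eq_0_iff sum_nonneg)
  then show ?thesis by (simp add: E_def G_def e_def)
qed

lemma gam_inner_gam: "gam H i \<bullet> gam H j = (if i = j then 1 else 0) - 1 / dd"
  using sum_row_row[of i j] by (simp add: inner_vec_def gam_nth)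

lemma sum_gam: "(\<Sum>i\<in>UNIV. gam H i) = 0"
  by (simp add: vec_eq_iff gam_nth sum_col)

lemma sum_inner_gam: "(\<Sum>i\<in>UNIV. gam H i \<bullet> x) = 0"
  by (simp add: inner_sum_left[symmetric] sum_gam)

lemma inner_H: "(H *v x) \<bullet> (H *v y) = x \<bullet> y"
proof -
  have "(H *v x) \<bullet> (H *v y) = x \<bullet> (transpose H *v (H *v y))"
    by (rule inner_matrix_vector_transpose)
  then show ?thesis by (simp add: matrix_vector_mul_assoc ortho)
qed

lemma norm_H: "norm (H *v x) = norm x"
  by (simp add: norm_eq_sqrt_inner inner_H)

lemma sum_inner_gam_sq: "(\<Sum>i\<in>UNIV. (gam H i \<bullet> x)\<^sup>2) = (norm x)\<^sup>2"
proof -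
  have "(\<Sum>i\<in>UNIV. (gam H i \<bullet> x)\<^sup>2) = (H *v x) \<bullet> (H *v x)"
    unfolding inner_gam by (simp add: inner_vec_def power2_eq_square)
  then show ?thesis by (simp add: inner_H power2_norm_eq_inner)
qed

lemma norm_gam_le: "norm (gam H i) \<le> 1"
proof -
  have "(norm (gam H i))\<^sup>2 \<le> 1\<^sup>2"
    using dd3 by (simp add: power2_norm_eq_inner gam_inner_gam)
  then show ?thesis by (rule power2_le_imp_le) simp
qed

text \<open>Since \<open>H\<close> is an isometry, Cauchy-Schwarz bounds |H^T y|^2 = y \<bullet> H
  H^T y by |y| |H^T y|. It is what lets an arbitrary estimator in R^d be pushed to R^(d-1) without
  increasing its error.\<close>

lemma norm_transpose_H_le: "norm (transpose H *v y) \<le> norm y"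
proof -
  have "(norm (transpose H *v y))\<^sup>2 = y \<bullet> (H *v (transpose H *v y))"
    using inner_matrix_vector_transpose[of H "transpose H *v y" y]
    by (simp add: power2_norm_eq_inner inner_commute)
  also have "\<dots> \<le> norm y * norm (transpose H *v y)"
    using norm_cauchy_schwarz[of y "H *v (transpose H *v y)"] by (simp add: norm_H)
  finally have le: "norm (transpose H *v y) * norm (transpose H *v y) \<le> norm y * norm (transpose H *v y)"
    by (simp add: power2_eq_square)
  show ?thesis
  proof (rule ccontr)
    assume neg: "\<not> ?thesis"
    then have "norm y < norm (transpose H *v y)" "0 < norm (transpose H *v y)"
      using norm_ge_zero[of y] by linarith+
    then show False using le mult_strict_right_mono by fastforce
  qed
qed

lemma H_hth:
  assumes "(\<Sum>i\<in>UNIV. \<theta> $ i) = 1"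
  shows "H *v hth H \<theta> = \<theta> - (\<chi> i. 1 / dd)"
proof -
  have "(H *v hth H \<theta>) $ i = \<theta> $ i - 1 / dd" for i
  proof -
    have "(H *v hth H \<theta>) $ i = (\<Sum>j\<in>UNIV. \<theta> $ j * (gam H i \<bullet> gam H j))"
      by (simp add: inner_gam[symmetric] hth_def inner_sum_right)
    also have "\<dots> = \<theta> $ i - 1 / dd"
      using assms by (simp add: gam_inner_gam right_diff_distrib sum_subtractf sum_divide_distrib[symmetric]
        mult.commute[of _ "if _ then _ else _"] if_distrib[where f = "\<lambda>z. z * _"] cong: if_cong)
    finally show ?thesis .
  qed
  then show ?thesis by (simp add: vec_eq_iff)
qed

text \<open>The numbers 1 + \<open>gam H j\<close> \<bullet> x are nonnegative with sum
  \<open>dd\<close>, so none exceeds \<open>dd\<close>. The resulting boundedness of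
  \<open>Xd H\<close> gives all integrability below and constants that do not depend on the
  law.\<close>

lemma Xd_le:
  assumes "x \<in> Xd H" shows "\<bar>gam H i \<bullet> x\<bar> \<le> dd"
proof -
  have ge: "0 \<le> 1 + gam H j \<bullet> x" for j using assms by (simp add: Xd_def)
  have "1 + gam H i \<bullet> x \<le> (\<Sum>j\<in>UNIV. 1 + gam H j \<bullet> x)"
    by (rule member_le_sum) (auto simp: ge)
  also have "\<dots> = dd" by (simp add: sum.distrib sum_inner_gam)
  finally show ?thesis using ge[of i] dd3 by auto
qed

lemma Xd_norm_le:
  assumes "x \<in> Xd H" shows "norm x \<le> dd\<^sup>2"
proof -
  have "norm x \<le> (\<Sum>i\<in>UNIV. \<bar>(H *v x) $ i\<bar>)"
    using norm_le_l1_cart[of "H *v x"] by (simp add: norm_H)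
  also have "\<dots> \<le> (\<Sum>i\<in>(UNIV::'d set). dd)"
    using Xd_le[OF assms] by (intro sum_mono) (simp add: inner_gam)
  finally show ?thesis by (simp add: power2_eq_square)
qed

lemma hth_lift: "hth H ((\<chi> i. 1 / dd) + H *v h) = h"
proof -
  have "(\<chi> i. 1 / dd) = (1/dd) *\<^sub>R ((\<chi> i. 1) :: real^'d)" by (simp add: vec_eq_iff)
  then show ?thesis
    using ortho_one by (simp add: hth_eq matrix_vector_right_distrib matrix_vector_mul_assoc ortho ortho_one matrix_vector_mult_scaleR)
qed

text \<open>Each coordinate moves from 1 / d by at most |h|, since \<open>norm_gam_le\<close>. Hence
  a small cube of parameters around h = 0 consists of admissible \<theta>.\<close>

lemma lift_simplex:
  assumes "norm h \<le> 1 / dd"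
  shows "(\<chi> i. 1 / dd) + H *v h \<in> prob_simplex"
proof -
  have "\<bar>gam H i \<bullet> h\<bar> \<le> 1 / dd" for i
    using Cauchy_Schwarz_ineq2[of "gam H i" h] mult_right_mono[OF norm_gam_le[of i], of "norm h"] assms by simp
  then have "0 \<le> 1 / dd + gam H i \<bullet> h" for i by (smt (verit))
  then show ?thesis
    using sum_inner_gam[of h] dd3 by (simp add: prob_simplex_def inner_gam sum.distrib)
qed

lemma simplex_density_nonneg:
  assumes "\<theta> \<in> prob_simplex" "x \<in> Xd H"
  shows "0 \<le> 1 + hth H \<theta> \<bullet> x"
proof -
  have "1 + hth H \<theta> \<bullet> x = (\<Sum>i\<in>UNIV. \<theta> $ i * (1 + gam H i \<bullet> x))"
    using assms(1) by (simp add: hth_def inner_sum_left prob_simplex_def algebra_simps sum.distrib)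
  also have "\<dots> \<ge> 0"
    using assms by (intro sum_nonneg mult_nonneg_nonneg) (auto simp: prob_simplex_def Xd_def)
  finally show ?thesis .
qed

end

section \<open>The budget controls the second moment\<close>

text \<open>The left side is the quadratic Hermite interpolant of 1 / u at the nodes a, b, b. The
  gap factors as (1 - u/a) (1 - u/b)^2 / u, so its sign is decided by u \<le> a alone.\<close>

lemma reciprocal_quadratic_minorant:
  fixes a b u :: real
  assumes "0 < b" "0 < u" "u \<le> a"
  shows "(1 / a + 2 / b) - (1 / b\<^sup>2 + 2 / (a * b)) * u + u\<^sup>2 / (a * b\<^sup>2) \<le> 1 / u"
proof -
  have a: "0 < a" using assms by simp
  have "0 \<le> (1 - u / a) * (1 - u / b)\<^sup>2 / u"
    using assms a by simp
  also have "\<dots> = 1 / u - ((1 / a + 2 / b) - (1 / b\<^sup>2 + 2 / (a * b)) * u + u\<^sup>2 / (a * b\<^sup>2))"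
    using assms a by (simp add: field_simps power2_eq_square)
  finally show ?thesis by simp
qed

text \<open>The extremal configuration has one coordinate \<open>a\<close> and all others equal to \<open>b\<close>; every
  configuration with the same sum and sum of squares has all coordinates at most \<open>a\<close>, where the
  cubic minorant touching \<open>1 / u\<close> at \<open>a\<close> and (doubly) at \<open>b\<close> applies.\<close>

lemma sum_sq_diff_div_ge:
  fixes u :: "'d::finite \<Rightarrow> real" and d :: real
  defines "d \<equiv> real CARD('d)"
  assumes d2: "2 \<le> CARD('d)" and pos: "\<And>i. 0 < u i" and sum_u: "(\<Sum>i\<in>UNIV. u i) = d"
  shows "(1 + sqrt (d - 1))\<^sup>2 * ((\<Sum>i\<in>UNIV. (u i)\<^sup>2) - d) \<le> (\<Sum>i\<in>UNIV. \<Sum>j\<in>UNIV. (u j - u i)\<^sup>2 / u i)"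
proof -
  define N where "N = d - 1"
  define S where "S = (\<Sum>i\<in>UNIV. (u i)\<^sup>2)"
  define R where "R = (\<Sum>i\<in>UNIV. 1 / u i)"
  define q where "q = S - d"
  have N: "1 \<le> N" using d2 by (simp add: N_def d_def)
  have dN: "d = N + 1" by (simp add: N_def)
  have cd: "real CARD('d) = d" by (simp add: d_def)
  have q_eq: "q = (\<Sum>i\<in>UNIV. (u i - 1)\<^sup>2)"
    unfolding q_def S_def power2_diff
    by (simp add: sum.distrib sum_subtractf sum_distrib_left[symmetric] sum_u cd)
  then have q0: "0 \<le> q" by (simp add: sum_nonneg)
  \<comment> \<open>With the sum fixed at d, the problem becomes to minimise the sum of reciprocals
    \<open>R\<close> for a given sum of squares \<open>S\<close>.\<close>
  have rhs: "(\<Sum>i\<in>UNIV. \<Sum>j\<in>UNIV. (u j - u i)\<^sup>2 / u i) = S * R - d\<^sup>2"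
  proof -
    have "(\<Sum>j\<in>UNIV. (u j - u i)\<^sup>2 / u i) = S * (1 / u i) - 2 * d + d * u i" for i
    proof -
      have "(\<Sum>j\<in>UNIV. (u j - u i)\<^sup>2) = S - 2 * d * u i + d * (u i)\<^sup>2"
        unfolding power2_diff S_def
        by (simp add: sum.distrib sum_subtractf sum_distrib_left[symmetric] sum_distrib_right[symmetric] sum_u cd)
      then show ?thesis
        using pos[of i] by (simp add: sum_divide_distrib[symmetric] field_simps power2_eq_square)
    qed
    then have "(\<Sum>i\<in>UNIV. \<Sum>j\<in>UNIV. (u j - u i)\<^sup>2 / u i) = S * R - d * (2 * d) + d * d"
      unfolding R_def
      by (simp add: sum.distrib sum_subtractf sum_distrib_left[symmetric] sum_u cd sum_distrib_left)
    then show ?thesis by (simp add: power2_eq_square)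
  qed
  show ?thesis
  proof (cases "q = 0")
    case True
    then have "S - d = 0" by (simp add: q_def)
    then show ?thesis using pos
      by (auto simp: S_def[symmetric] intro!: sum_nonneg divide_nonneg_pos)
  next
    case False
    \<comment> \<open>\<alpha> is solved for so that one coordinate \<open>a\<close> and
      \<open>N\<close> coordinates \<open>b\<close> have sum \<open>d\<close> and sum of squares
      \<open>S\<close>.\<close>
    define \<alpha> where "\<alpha> = sqrt (q * N / d)"
    define a where "a = 1 + \<alpha>"
    define b where "b = 1 - \<alpha> / N"
    have q_pos: "0 < q" using False q0 by simp
    have \<alpha>: "0 < \<alpha>" using q_pos N by (simp add: \<alpha>_def dN)
    have \<alpha>2: "d * \<alpha>\<^sup>2 = q * N" using q_pos N by (simp add: \<alpha>_def dN)
    have ab: "a + N * b = d" using N by (simp add: a_def b_def dN right_diff_distrib)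
    have amb: "a - b = \<alpha> * d / N" using N by (simp add: a_def b_def dN field_simps)
    have qab: "q * d = N * (a - b)\<^sup>2"
    proof -
      have "N * (a - b)\<^sup>2 = d * (d * \<alpha>\<^sup>2) / N"
        using N by (simp add: amb field_simps power2_eq_square)
      also have "\<dots> = q * d" using N by (simp add: \<alpha>2)
      finally show ?thesis by simp
    qed
    have S_ab: "S = a\<^sup>2 + N * b\<^sup>2"
    proof -
      have "S * d = (a + N * b)\<^sup>2 + N * (a - b)\<^sup>2"
        using qab by (simp add: q_def ab power2_eq_square algebra_simps)
      also have "\<dots> = (a\<^sup>2 + N * b\<^sup>2) * d"
        by (simp add: dN power2_eq_square algebra_simps)
      finally show ?thesis using N by (simp add: dN)
    qed
    \<comment> \<open>Cauchy-Schwarz on the other \<open>N\<close> deviations, whose sum is 1 -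
      \<open>u i\<close>, caps the share of the variance \<open>q\<close> that coordinate i can
      carry.\<close>
    have u_le: "u i \<le> a" for i
    proof -
      have "(\<Sum>j\<in>UNIV-{i}. u j - 1)\<^sup>2 \<le> (\<Sum>j\<in>UNIV-{i}. (u j - 1)\<^sup>2) * real (card (UNIV - {i}))"
        by (rule sum_squared_le_sum_of_squares)
      moreover have "real (card (UNIV - {i})) = N"
        using d2 by (simp add: card_Diff_singleton N_def d_def of_nat_diff)
      moreover have "(\<Sum>j\<in>UNIV-{i}. u j - 1) = 1 - u i"
        by (simp add: sum_diff1 sum_subtractf sum_u cd)
      moreover have "(\<Sum>j\<in>UNIV-{i}. (u j - 1)\<^sup>2) = q - (u i - 1)\<^sup>2"
        by (simp add: sum_diff1 q_eq)
      ultimately have "(u i - 1)\<^sup>2 \<le> N * (q - (u i - 1)\<^sup>2)"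
        by (simp add: power2_commute mult.commute)
      then have "d * (u i - 1)\<^sup>2 \<le> d * \<alpha>\<^sup>2"
        unfolding \<alpha>2 by (simp add: dN algebra_simps)
      then have "(u i - 1)\<^sup>2 \<le> \<alpha>\<^sup>2" using N by (simp add: dN)
      then have "u i - 1 \<le> \<alpha>" using \<alpha> by (simp add: abs_le_square_iff[symmetric])
      then show ?thesis by (simp add: a_def)
    qed
    \<comment> \<open>Positivity of the \<open>u i\<close> enters here: each is then strictly below
      \<open>d\<close>, so \<open>S\<close> < d^2, which amounts to \<alpha> <
      \<open>N\<close>.\<close>
    have b: "0 < b"
    proof -
      have lt: "u i < d" for i
      proof -
        have "card (UNIV - {i}) \<noteq> 0"
          using d2 by (simp add: card_Diff_singleton)
        then have "UNIV - {i} \<noteq> {}" by (metis card.empty)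
        then have "0 < (\<Sum>j\<in>UNIV - {i}. u j)"
          by (intro sum_pos) (auto simp: pos)
        then show ?thesis by (simp add: sum_diff1 sum_u)
      qed
      have "S < (\<Sum>i\<in>UNIV. u i * d)"
        unfolding S_def power2_eq_square
        by (intro sum_strict_mono) (auto simp: pos lt)
      then have "S < d * d" by (simp add: sum_distrib_right[symmetric] sum_u)
      then have "q < d * N" by (simp add: q_def N_def algebra_simps)
      then have "q * N < d * N * N" using N by (intro mult_strict_right_mono) auto
      then have "d * \<alpha>\<^sup>2 < d * N\<^sup>2" unfolding \<alpha>2 by (simp only: power2_eq_square mult.assoc)
      then have "\<alpha>\<^sup>2 < N\<^sup>2" using N by (simp add: dN)
      then have "\<alpha> < N" using N by (intro power2_less_imp_less[of \<alpha> N]) auto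
      then show ?thesis using N by (simp add: b_def)
    qed
    have a: "0 < a" using \<alpha> by (simp add: a_def)
    have "d * (1 / a + 2 / b) - (1 / b\<^sup>2 + 2 / (a * b)) * d + S / (a * b\<^sup>2)
        = (\<Sum>i\<in>UNIV. (1 / a + 2 / b) - (1 / b\<^sup>2 + 2 / (a * b)) * u i + (u i)\<^sup>2 / (a * b\<^sup>2))"
      by (simp add: sum.distrib sum_subtractf sum_distrib_left[symmetric] sum_divide_distrib[symmetric] S_def sum_u cd)
    also have "\<dots> \<le> R"
      unfolding R_def by (intro sum_mono reciprocal_quadratic_minorant b pos u_le)
    \<comment> \<open>The summed minorant depends only on \<open>d\<close> and \<open>S\<close>, so
      it may be evaluated at the extremal configuration, where it agrees with 1 / u at every
      coordinate.\<close>
    also have "d * (1 / a + 2 / b) - (1 / b\<^sup>2 + 2 / (a * b)) * d + S / (a * b\<^sup>2) = 1 / a + N / b"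
    proof -
      have "d * (1 / a + 2 / b) - (1 / b\<^sup>2 + 2 / (a * b)) * (a + N * b) + (a\<^sup>2 + N * b\<^sup>2) / (a * b\<^sup>2) = 1 / a + N / b"
        using a b by (simp add: dN field_simps power2_eq_square)
      then show ?thesis by (simp add: S_ab ab)
    qed
    finally have R_ge: "1 / a + N / b \<le> R" .
    have S0: "0 \<le> S" by (simp add: S_def sum_nonneg)
    have sqN: "(sqrt N)\<^sup>2 = N" using N by simp
    \<comment> \<open>The only other loss: equality holds exactly when a / b = sqrt(d - 1), the
      value of \<open>lam_star\<close>.\<close>
    have "0 \<le> (a - sqrt N * b)\<^sup>2" by simp
    then have "(1 + sqrt N)\<^sup>2 * (a * b) \<le> (a + N * b) * (a + b)"
      using sqN by (simp add: power2_eq_square algebra_simps)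
    then have key: "(1 + sqrt N)\<^sup>2 \<le> d * (1 / a + 1 / b)"
      using a b by (simp add: ab field_simps)
    have "(1 + sqrt N)\<^sup>2 * q \<le> d * (1 / a + 1 / b) * q"
      using key q0 by (rule mult_right_mono)
    also have "\<dots> = N * (a - b)\<^sup>2 * (1 / a + 1 / b)"
      using qab by (simp add: mult_ac)
    also have "\<dots> = S * (1 / a + N / b) - (a + N * b) * d"
      using a b by (simp add: S_ab dN field_simps power2_eq_square)
    also have "\<dots> \<le> S * R - d\<^sup>2"
      using mult_left_mono[OF R_ge S0] by (simp add: ab power2_eq_square)
    finally show ?thesis by (simp add: rhs q_def S_def N_def)
  qed
qed

context simplex_frame begin

text \<open>If all u_i = 1 + \<open>gam H i\<close> \<bullet> x are positive, this is
  \<open>sum_sq_diff_div_ge\<close>, because the squares of the u_i sum to d + |x|^2 and the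
  diagonal pairs contribute zero. If some u_i vanishes, another u_j does not, since they sum to d,
  and the pair (i, j) makes the right side infinite.\<close>

lemma sum_chi_integrand_ge:
  assumes x: "x \<in> Xd H"
  shows "ennreal ((dd + 2 * sqrt (dd - 1)) * (norm x)\<^sup>2)
    \<le> (\<Sum>ij\<in>{(i, j). i \<noteq> j}. chi_integrand H (fst ij) (snd ij) x)"
proof (cases "\<forall>i. 0 < 1 + gam H i \<bullet> x")
  case True
  define u where "u i = 1 + gam H i \<bullet> x" for i
  have su: "(\<Sum>i\<in>UNIV. u i) = dd"
    by (simp add: u_def sum.distrib sum_inner_gam)
  have S: "(\<Sum>i\<in>UNIV. (u i)\<^sup>2) - dd = (norm x)\<^sup>2"
    by (simp add: u_def power2_sum sum.distrib sum_distrib_left[symmetric] sum_inner_gam sum_inner_gam_sq)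
  have kap: "(1 + sqrt (dd - 1))\<^sup>2 = dd + 2 * sqrt (dd - 1)"
    using dd3 by (simp add: power2_sum)
  have "(dd + 2 * sqrt (dd - 1)) * (norm x)\<^sup>2 \<le> (\<Sum>i\<in>UNIV. \<Sum>j\<in>UNIV. (u j - u i)\<^sup>2 / u i)"
    using sum_sq_diff_div_ge[of u] True su dim3 by (simp add: S kap) (simp add: u_def)
  also have "\<dots> = (\<Sum>ij\<in>UNIV. (u (snd ij) - u (fst ij))\<^sup>2 / u (fst ij))"
    by (simp add: sum.cartesian_product case_prod_unfold)
  also have "\<dots> = (\<Sum>ij\<in>{(i, j). i \<noteq> j}. (u (snd ij) - u (fst ij))\<^sup>2 / u (fst ij))"
    by (rule sum.mono_neutral_right) auto
  finally have "ennreal ((dd + 2 * sqrt (dd - 1)) * (norm x)\<^sup>2)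
     \<le> (\<Sum>ij\<in>{(i, j). i \<noteq> j}. ennreal ((u (snd ij) - u (fst ij))\<^sup>2 / u (fst ij)))"
    using True by (subst sum_ennreal) (auto simp: u_def intro!: ennreal_leI divide_nonneg_pos)
  also have "\<dots> = (\<Sum>ij\<in>{(i, j). i \<noteq> j}. chi_integrand H (fst ij) (snd ij) x)"
    using True by (intro sum.cong refl) (simp add: chi_integrand_def u_def inner_diff_left)
  finally show ?thesis .
next
  case False
  then obtain i where i: "1 + gam H i \<bullet> x = 0"
    using x unfolding Xd_def mem_Collect_eq by (metis order_le_less)
  have "\<exists>j. 1 + gam H j \<bullet> x \<noteq> 0"
  proof (rule ccontr)
    assume "\<not> ?thesis"
    then have "(\<Sum>j\<in>UNIV. 1 + gam H j \<bullet> x) = 0" by simp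
    then show False using dd3 by (simp add: sum.distrib sum_inner_gam)
  qed
  then obtain j where j: "1 + gam H j \<bullet> x \<noteq> 0" by auto
  then have ij: "(i, j) \<in> {(i, j). i \<noteq> j}" using i by auto
  have "chi_integrand H i j x = \<infinity>"
    using i j by (simp add: chi_integrand_def inner_diff_left)
  moreover have "chi_integrand H i j x \<le> (\<Sum>ij\<in>{(i, j). i \<noteq> j}. chi_integrand H (fst ij) (snd ij) x)"
    using member_le_sum[OF ij, of "\<lambda>ij. chi_integrand H (fst ij) (snd ij) x"] by simp
  ultimately have "(\<Sum>ij\<in>{(i, j). i \<noteq> j}. chi_integrand H (fst ij) (snd ij) x) = \<top>"
    by (metis infinity_ennreal_def top_unique)
  then show ?thesis by (simp only: top_greatest)
qed

lemma chi_integrand_measurable [measurable]: "chi_integrand H i j \<in> borel_measurable borel"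
  unfolding chi_integrand_def Let_def by measurable

lemma anchored_second_moment_le:
  assumes "\<rho> \<in> anchored H" and chi: "chi_star H \<rho> \<le> ennreal C" and C: "0 \<le> C"
  shows "(\<integral>\<^sup>+ x. ennreal ((norm x)\<^sup>2) \<partial>\<rho>) \<le> ennreal (dd * (dd - 1) * C / (dd + 2 * sqrt (dd - 1)))"
proof -
  define \<kappa> where "\<kappa> = dd + 2 * sqrt (dd - 1)"
  have \<kappa>: "0 < \<kappa>" using dd3 by (simp add: \<kappa>_def add_pos_nonneg)
  have [simp, measurable_cong]: "sets \<rho> = sets borel" and AE: "AE x in \<rho>. x \<in> Xd H"
    using assms(1) by (auto simp: anchored_def)
  \<comment> \<open>The factor \<open>dd * (dd - 1)\<close> in the bound counts the ordered pairs,
    each of whose integrals is at most C.\<close>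
  have card: "card {(i, j). i \<noteq> (j::'d)} = CARD('d) * (CARD('d) - 1)"
  proof -
    have "{(i, j). i \<noteq> (j::'d)} = (SIGMA i:UNIV. UNIV - {i})" by auto
    then show ?thesis by (simp add: card_Diff_singleton)
  qed
  have "ennreal \<kappa> * (\<integral>\<^sup>+ x. ennreal ((norm x)\<^sup>2) \<partial>\<rho>) = (\<integral>\<^sup>+ x. ennreal (\<kappa> * (norm x)\<^sup>2) \<partial>\<rho>)"
    using \<kappa> by (subst nn_integral_cmult[symmetric]) (auto simp: ennreal_mult)
  also have "\<dots> \<le> (\<integral>\<^sup>+ x. (\<Sum>ij\<in>{(i, j). i \<noteq> j}. chi_integrand H (fst ij) (snd ij) x) \<partial>\<rho>)"
    using AE by (intro nn_integral_mono_AE) (auto simp: \<kappa>_def intro: sum_chi_integrand_ge)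
  also have "\<dots> = (\<Sum>ij\<in>{(i, j). i \<noteq> j}. \<integral>\<^sup>+ x. chi_integrand H (fst ij) (snd ij) x \<partial>\<rho>)"
    by (rule nn_integral_sum) simp
  also have "\<dots> \<le> (\<Sum>ij\<in>{(i, j). i \<noteq> (j::'d)}. ennreal C)"
    using chi unfolding chi_star_def by (intro sum_mono) (auto simp: SUP_le_iff)
  also have "\<dots> = ennreal (dd * (dd - 1) * C)"
    using dim3 C dd3 by (simp add: card of_nat_diff ennreal_of_nat_eq_real_of_nat ennreal_mult[symmetric])
  finally have "ennreal \<kappa> * (\<integral>\<^sup>+ x. ennreal ((norm x)\<^sup>2) \<partial>\<rho>) \<le> ennreal (dd * (dd - 1) * C)" .
  then have "ennreal (1 / \<kappa>) * (ennreal \<kappa> * (\<integral>\<^sup>+ x. ennreal ((norm x)\<^sup>2) \<partial>\<rho>))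
      \<le> ennreal (1 / \<kappa>) * ennreal (dd * (dd - 1) * C)"
    by (intro mult_left_mono) auto
  then show ?thesis
    using \<kappa> C dd3 by (simp add: mult.assoc[symmetric] ennreal_mult[symmetric] \<kappa>_def[symmetric])
qed

end

section \<open>The van Trees inequality\<close>

text \<open>Variance of a sum of independent centred variables. The shift \<open>a\<close> is what
  makes the induction close: the value of the new sample is absorbed into it, and the cross term
  disappears by \<open>mean\<close>.\<close>

lemma nn_integral_PiM_sum_sq:
  fixes f :: "'b \<Rightarrow> real"
  assumes "prob_space Q" and [measurable]: "f \<in> borel_measurable Q"
    and int: "integrable Q f" "integrable Q (\<lambda>x. (f x)\<^sup>2)" and mean: "(\<integral>x. f x \<partial>Q) = 0"
  shows "(\<integral>\<^sup>+ \<omega>. ennreal ((a + (\<Sum>m<n. f (\<omega> m)))\<^sup>2) \<partial>PiM {..<n} (\<lambda>_. Q))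
    = ennreal (a\<^sup>2 + real n * (\<integral>x. (f x)\<^sup>2 \<partial>Q))"
proof (induction n arbitrary: a)
  case 0
  show ?case
    using prob_space.emeasure_space_1[OF prob_space_PiM[of "{..<0::nat}" "\<lambda>_. Q"]] assms(1) by simp
next
  case (Suc n)
  interpret Q: prob_space Q by fact
  interpret product_prob_space "\<lambda>_::nat. Q" using assms(1) by (simp add: product_prob_spaceI)
  have eq: "(\<Sum>m<n. f ((fun_upd \<omega> n y) m)) = (\<Sum>m<n. f (\<omega> m))" for \<omega> :: "nat \<Rightarrow> 'b" and y
    by (intro sum.cong) auto
  have "(\<integral>\<^sup>+ \<omega>. ennreal ((a + (\<Sum>m<Suc n. f (\<omega> m)))\<^sup>2) \<partial>PiM {..<Suc n} (\<lambda>_. Q))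
      = (\<integral>\<^sup>+ y. \<integral>\<^sup>+ \<omega>. ennreal ((a + (\<Sum>m<Suc n. f ((fun_upd \<omega> n y) m)))\<^sup>2) \<partial>PiM {..<n} (\<lambda>_. Q) \<partial>Q)"
    unfolding lessThan_Suc by (rule product_nn_integral_insert_rev) auto
  also have "\<dots> = (\<integral>\<^sup>+ y. \<integral>\<^sup>+ \<omega>. ennreal (((a + f y) + (\<Sum>m<n. f (\<omega> m)))\<^sup>2) \<partial>PiM {..<n} (\<lambda>_. Q) \<partial>Q)"
    by (simp add: eq add_ac)
  also have "\<dots> = (\<integral>\<^sup>+ y. ennreal ((a + f y)\<^sup>2 + real n * (\<integral>x. (f x)\<^sup>2 \<partial>Q)) \<partial>Q)"
    by (simp only: Suc.IH)
  also have "\<dots> = ennreal (\<integral>y. (a + f y)\<^sup>2 + real n * (\<integral>x. (f x)\<^sup>2 \<partial>Q) \<partial>Q)"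
  proof (intro nn_integral_eq_integral AE_I2)
    show "integrable Q (\<lambda>y. (a + f y)\<^sup>2 + real n * (\<integral>x. (f x)\<^sup>2 \<partial>Q))"
      using int by (auto simp: power2_sum)
  qed (simp add: integral_nonneg)
  also have "(\<integral>y. (a + f y)\<^sup>2 + real n * (\<integral>x. (f x)\<^sup>2 \<partial>Q) \<partial>Q) = a\<^sup>2 + real (Suc n) * (\<integral>x. (f x)\<^sup>2 \<partial>Q)"
    using int by (simp add: power2_sum mean Q.prob_space algebra_simps)
  finally show ?case .
qed

text \<open>Checked on measurable rectangles, where both sides factor. It lets the models for all
  parameters be written over one base measure, as \<open>van_trees\<close> requires.\<close>

lemma PiM_density_same:
  fixes f :: "'b \<Rightarrow> ennreal"
  assumes I: "finite I" and M: "prob_space M" and D: "prob_space (density M f)"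
    and [measurable]: "f \<in> borel_measurable M"
  shows "PiM I (\<lambda>_. density M f) = density (PiM I (\<lambda>_. M)) (\<lambda>\<omega>. \<Prod>i\<in>I. f (\<omega> i))"
proof -
  interpret M: product_prob_space "\<lambda>_. M" using M by (simp add: product_prob_spaceI)
  interpret D: product_prob_space "\<lambda>_. density M f" using D by (simp add: product_prob_spaceI)
  show ?thesis
  proof (rule D.PiM_eqI[symmetric, OF I])
    show "sets (density (PiM I (\<lambda>_. M)) (\<lambda>\<omega>. \<Prod>i\<in>I. f (\<omega> i))) = sets (PiM I (\<lambda>_. density M f))"
      using sets_PiM_cong[OF refl, of I "\<lambda>_. M" "\<lambda>_. density M f"] by simp
    fix A assume A: "\<And>i. i \<in> I \<Longrightarrow> A i \<in> sets (density M f)"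
    then have [measurable]: "\<And>i. i \<in> I \<Longrightarrow> A i \<in> sets M" by simp
    have [measurable]: "Pi\<^sub>E I A \<in> sets (PiM I (\<lambda>_. M))"
      using I A by (intro sets_PiM_I_finite) auto
    have "emeasure (density (PiM I (\<lambda>_. M)) (\<lambda>\<omega>. \<Prod>i\<in>I. f (\<omega> i))) (Pi\<^sub>E I A)
        = (\<integral>\<^sup>+ \<omega>. (\<Prod>i\<in>I. f (\<omega> i)) * indicator (Pi\<^sub>E I A) \<omega> \<partial>PiM I (\<lambda>_. M))"
      by (rule emeasure_density) auto
    also have "\<dots> = (\<integral>\<^sup>+ \<omega>. (\<Prod>i\<in>I. f (\<omega> i) * indicator (A i) (\<omega> i)) \<partial>PiM I (\<lambda>_. M))"
    proof (rule nn_integral_cong)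
      fix \<omega> assume "\<omega> \<in> space (PiM I (\<lambda>_. M))"
      then have "indicator (Pi\<^sub>E I A) \<omega> = (\<Prod>i\<in>I. indicator (A i) (\<omega> i) :: ennreal)"
        using I by (auto simp: indicator_def space_PiM PiE_iff prod.neutral)
      then show "(\<Prod>i\<in>I. f (\<omega> i)) * indicator (Pi\<^sub>E I A) \<omega> = (\<Prod>i\<in>I. f (\<omega> i) * indicator (A i) (\<omega> i))"
        by (simp add: prod.distrib)
    qed
    also have "\<dots> = (\<Prod>i\<in>I. \<integral>\<^sup>+ x. f x * indicator (A i) x \<partial>M)"
      using I by (rule M.product_nn_integral_prod) auto
    also have "\<dots> = (\<Prod>i\<in>I. emeasure (density M f) (A i))"
      by (intro prod.cong refl emeasure_density[symmetric]) auto
    finally show "emeasure (density (PiM I (\<lambda>_. M)) (\<lambda>\<omega>. \<Prod>i\<in>I. f (\<omega> i))) (Pi\<^sub>E I A)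
        = (\<Prod>i\<in>I. emeasure (density M f) (A i))" .
  qed
qed

section \<open>A polynomial prior on an interval and its Fisher information\<close>

text \<open>The square root of the prior density on [-r, r]; the integral of (r^2 - s^2)^2 there is
  16 r^5 / 15, hence the constant. Working with the root keeps everything polynomial, so the prior
  score never has to be written as a quotient by a density that vanishes at the ends.\<close>

definition prior_root :: "real \<Rightarrow> real \<Rightarrow> real" where
  "prior_root r s = sqrt (15 / (16 * r ^ 5)) * (r\<^sup>2 - s\<^sup>2)"

lemma prior_root_sq:
  assumes "0 < r"
  shows "(prior_root r s)\<^sup>2 = 15 / (16 * r ^ 5) * (r\<^sup>2 - s\<^sup>2)\<^sup>2"
  using assms by (simp add: prior_root_def power_mult_distrib)

definition prior_root' :: "real \<Rightarrow> real \<Rightarrow> real" where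
  "prior_root' r s = sqrt (15 / (16 * r ^ 5)) * (- 2 * s)"

lemma prior_root'_sq:
  assumes "0 < r"
  shows "(2 * prior_root' r s)\<^sup>2 = 15 / (16 * r ^ 5) * (16 * s\<^sup>2)"
  using assms by (simp add: prior_root'_def power_mult_distrib)

definition prior :: "real \<Rightarrow> real measure" where
  "prior r = density lborel (\<lambda>s. ennreal ((prior_root r s)\<^sup>2) * indicator {-r..r} s)"

lemma prior_root_deriv: "(prior_root r has_real_derivative prior_root' r s) (at s)"
  unfolding prior_root_def prior_root'_def by (auto intro!: derivative_eq_intros)

lemma prior_root_measurable [measurable]:
  "prior_root r \<in> borel_measurable borel" "prior_root' r \<in> borel_measurable borel"
  unfolding prior_root_def prior_root'_def by measurable

lemma continuous_prior_root [continuous_intros]: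
  "continuous_on A (prior_root r)" "continuous_on A (prior_root' r)"
  unfolding prior_root_def prior_root'_def by (intro continuous_intros)+

lemma sets_prior [measurable_cong, simp]: "sets (prior r) = sets borel"
  by (simp add: prior_def)

lemma nn_integral_prior:
  assumes [measurable]: "f \<in> borel_measurable borel"
  shows "integral\<^sup>N (prior r) f = (\<integral>\<^sup>+ s. ennreal ((prior_root r s)\<^sup>2) * f s * indicator {-r..r} s \<partial>lborel)"
  unfolding prior_def by (subst nn_integral_density) (auto simp: mult_ac)

lemma prior_root_sq_integral:
  assumes r: "0 < r"
  shows "(\<integral>\<^sup>+ s. ennreal ((prior_root r s)\<^sup>2) * indicator {-r..r} s \<partial>lborel) = 1"
proof -
  define F where "F = (\<lambda>s. 15 / (16 * r ^ 5) * (r ^ 4 * s - 2 * r\<^sup>2 * s ^ 3 / 3 + s ^ 5 / 5))"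
  have "(\<integral>\<^sup>+ s. ennreal ((prior_root r s)\<^sup>2) * indicator {-r..r} s \<partial>lborel) = ennreal (F r - F (-r))"
  proof (rule nn_integral_FTC_Icc)
    fix s :: real
    show "(F has_real_derivative (prior_root r s)\<^sup>2) (at s)"
      unfolding F_def prior_root_sq[OF r]
      by (intro DERIV_cmult) (auto intro!: derivative_eq_intros simp: power2_eq_square eval_nat_numeral algebra_simps)
  qed (use r in auto)
  also have "F r - F (-r) = 1"
    using r by (simp add: F_def field_simps power2_eq_square power3_eq_cube eval_nat_numeral)
  finally show ?thesis by simp
qed

text \<open>For a density g^2 the score times g is 2 g', so this value is the Fisher information of
  the prior. It is the source of every 10 / r^2 below.\<close>

lemma prior_root'_sq_integral:
  assumes r: "0 < r"
  shows "(\<integral>\<^sup>+ s. ennreal ((2 * prior_root' r s)\<^sup>2) * indicator {-r..r} s \<partial>lborel) = ennreal (10 / r\<^sup>2)"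
proof -
  define F where "F = (\<lambda>s. 15 / (16 * r ^ 5) * (16 * s ^ 3 / 3))"
  have "(\<integral>\<^sup>+ s. ennreal ((2 * prior_root' r s)\<^sup>2) * indicator {-r..r} s \<partial>lborel) = ennreal (F r - F (-r))"
  proof (rule nn_integral_FTC_Icc)
    fix s :: real
    show "(F has_real_derivative (2 * prior_root' r s)\<^sup>2) (at s)"
      unfolding F_def prior_root'_sq[OF r]
      by (intro DERIV_cmult) (auto intro!: derivative_eq_intros simp: power2_eq_square)
  qed (use r in auto)
  also have "F r - F (-r) = 10 / r\<^sup>2"
    using r by (simp add: F_def field_simps power2_eq_square power3_eq_cube eval_nat_numeral)
  finally show ?thesis by simp
qed

lemma prob_space_prior: "0 < r \<Longrightarrow> prob_space (prior r)"
  using nn_integral_prior[of "\<lambda>_. 1" r] prior_root_sq_integral[of r]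
  by (intro prob_spaceI) simp

text \<open>Integrating the square \<open>L ((T - s) g - c (\<psi> g + 2 g'))\<^sup>2 \<ge> 0\<close> with \<open>g\<^sup>2\<close> the prior density: the cross term
  is \<open>(T - s) (L g\<^sup>2)'\<close>, which integrates by parts to \<open>L g\<^sup>2\<close> because \<open>g (\<plusminus> r) = 0\<close>.\<close>

lemma van_trees_pointwise:
  fixes L \<psi> :: "real \<Rightarrow> real"
  assumes r: "0 < r" and c: "0 \<le> c"
    and L': "\<And>s. s \<in> {-r..r} \<Longrightarrow> (L has_real_derivative L s * \<psi> s) (at s)"
    and L0: "\<And>s. s \<in> {-r..r} \<Longrightarrow> 0 \<le> L s"
    and \<psi>: "continuous_on {-r..r} \<psi>"
  shows "(\<integral>\<^sup>+ s. ennreal (2 * c * (L s * (prior_root r s)\<^sup>2)) * indicator {-r..r} s \<partial>lborel)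
    \<le> (\<integral>\<^sup>+ s. ennreal ((T - s)\<^sup>2 * L s * (prior_root r s)\<^sup>2
          + c\<^sup>2 * (L s * (\<psi> s * prior_root r s + 2 * prior_root' r s)\<^sup>2)) * indicator {-r..r} s \<partial>lborel)"
proof -
  define g where "g = prior_root r"
  define g' where "g' = prior_root' r"
  have contL: "continuous_on {-r..r} L"
    using L' by (intro continuous_at_imp_continuous_on ballI) (blast dest: DERIV_isCont)
  have contg: "continuous_on {-r..r} g" "continuous_on {-r..r} g'"
    by (auto simp: g_def g'_def intro: continuous_intros)
  note cont = contL contg \<psi>
  define F where "F s = (T - s) * L s * (g s)\<^sup>2" for s
  define f where "f s = - (L s * (g s)\<^sup>2) + (T - s) * L s * g s * (\<psi> s * g s + 2 * g' s)" for s
  define A where "A s = (T - s)\<^sup>2 * L s * (g s)\<^sup>2 + c\<^sup>2 * (L s * (\<psi> s * g s + 2 * g' s)\<^sup>2)" for s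
  have F: "(F has_real_derivative f s) (at s)" if "s \<in> {-r..r}" for s
    unfolding F_def f_def
    by (auto intro!: derivative_eq_intros L'[OF that] prior_root_deriv[of r, folded g_def g'_def]
        simp: power2_eq_square algebra_simps)
  have contf: "continuous_on {-r..r} f"
    unfolding f_def by (intro continuous_intros cont)
  have contA: "continuous_on {-r..r} A"
    unfolding A_def by (intro continuous_intros cont)
  have A0: "0 \<le> A s" if "s \<in> {-r..r}" for s
    using L0[OF that] by (simp add: A_def)
  have contB: "continuous_on {-r..r} (\<lambda>s. 2 * c * (L s * (g s)\<^sup>2))"
    by (intro continuous_intros cont)
  have ints: "integrable lborel (\<lambda>s. indicator {-r..r} s *\<^sub>R h s)" if "continuous_on {-r..r} h" for h :: "real \<Rightarrow> real"
    using borel_integrable_compact[of "{-r..r}" h] that by (simp add: indicator_scaleR_eq_if)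
  have f0: "(\<integral>s. indicator {-r..r} s *\<^sub>R f s \<partial>lborel) = F r - F (-r)"
    using r F contf
    by (intro integral_FTC_Icc)
       (auto simp: has_real_derivative_iff_has_vector_derivative[symmetric] intro: DERIV_subset)
  have F0: "F r = 0" "F (-r) = 0"
    by (simp_all add: F_def g_def prior_root_def)
  \<comment> \<open>By \<open>f0\<close> and \<open>F0\<close> the derivative \<open>f\<close>
    integrates to zero, so adding 2 c \<open>f\<close> changes nothing; after the addition the
    comparison with \<open>A\<close> holds pointwise.\<close>
  have "(\<integral>s. indicator {-r..r} s *\<^sub>R (2 * c * (L s * (g s)\<^sup>2)) \<partial>lborel)
     = (\<integral>s. indicator {-r..r} s *\<^sub>R (2 * c * (L s * (g s)\<^sup>2)) + 2 * c * (indicator {-r..r} s *\<^sub>R f s) \<partial>lborel)"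
    by (subst Bochner_Integration.integral_add[OF ints[OF contB] integrable_mult_right[OF ints[OF contf]]],
        subst integral_mult_right_zero) (simp only: f0 F0 diff_self mult_zero_right add_0_right)
  also have "\<dots> \<le> (\<integral>s. indicator {-r..r} s *\<^sub>R A s \<partial>lborel)"
  proof (rule integral_mono)
    show "integrable lborel (\<lambda>s. indicator {-r..r} s *\<^sub>R (2 * c * (L s * (g s)\<^sup>2)) + 2 * c * (indicator {-r..r} s *\<^sub>R f s))"
      using ints[OF contB] ints[OF contf] by auto
    show "integrable lborel (\<lambda>s. indicator {-r..r} s *\<^sub>R A s)" by (rule ints[OF contA])
    fix s :: real
    have "2 * c * (L s * (g s)\<^sup>2) + 2 * c * f s \<le> A s" if "s \<in> {-r..r}"
    proof -
      have "A s - (2 * c * (L s * (g s)\<^sup>2) + 2 * c * f s) = L s * ((T - s) * g s - c * (\<psi> s * g s + 2 * g' s))\<^sup>2"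
        by (simp add: A_def f_def power2_eq_square algebra_simps)
      also have "\<dots> \<ge> 0" using L0[OF that] by simp
      finally show ?thesis by simp
    qed
    then show "indicator {-r..r} s *\<^sub>R (2 * c * (L s * (g s)\<^sup>2)) + 2 * c * (indicator {-r..r} s *\<^sub>R f s)
        \<le> indicator {-r..r} s *\<^sub>R A s"
      by (auto simp: indicator_def)
  qed
  finally have le: "(\<integral>s. indicator {-r..r} s *\<^sub>R (2 * c * (L s * (g s)\<^sup>2)) \<partial>lborel) \<le> (\<integral>s. indicator {-r..r} s *\<^sub>R A s \<partial>lborel)" .
  have nn: "(\<integral>\<^sup>+ s. ennreal (h s) * indicator {-r..r} s \<partial>lborel) = ennreal (\<integral>s. indicator {-r..r} s *\<^sub>R h s \<partial>lborel)"
    if "continuous_on {-r..r} h" "\<And>s. s \<in> {-r..r} \<Longrightarrow> 0 \<le> h s" for h :: "real \<Rightarrow> real"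
  proof -
    have "(\<integral>\<^sup>+ s. ennreal (h s) * indicator {-r..r} s \<partial>lborel) = (\<integral>\<^sup>+ s. ennreal (indicator {-r..r} s *\<^sub>R h s) \<partial>lborel)"
      by (intro nn_integral_cong) (auto simp: indicator_def)
    also have "\<dots> = ennreal (\<integral>s. indicator {-r..r} s *\<^sub>R h s \<partial>lborel)"
      using ints[OF that(1)] that(2) by (intro nn_integral_eq_integral) (auto simp: indicator_def)
    finally show ?thesis .
  qed
  have "(\<integral>\<^sup>+ s. ennreal (2 * c * (L s * (g s)\<^sup>2)) * indicator {-r..r} s \<partial>lborel)
     \<le> (\<integral>\<^sup>+ s. ennreal (A s) * indicator {-r..r} s \<partial>lborel)"
    using c L0 le A0 by (subst (1 2) nn) (auto intro!: contA contB ennreal_leI)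
  then show ?thesis by (simp add: A_def g_def g'_def)
qed

text \<open>The pathwise inequality averaged over the sample. The parameter \<open>c\<close> stays
  free instead of being optimised into a quotient, so that several coordinates can later share it.
  Quantifying \<open>fisher\<close> over all \<alpha> and \<beta> encodes two facts at once: the
  score \<psi> has second moment at most \<open>J\<close> and, as the cross term must vanish, mean
  zero.\<close>

lemma van_trees:
  fixes L \<psi> :: "real \<Rightarrow> 'a \<Rightarrow> real"
  assumes M: "prob_space M" and r: "0 < r" and c: "0 \<le> c" and J: "0 \<le> J"
    and [measurable]: "T \<in> borel_measurable M" "case_prod L \<in> borel_measurable (borel \<Otimes>\<^sub>M M)"
      "case_prod \<psi> \<in> borel_measurable (borel \<Otimes>\<^sub>M M)"
    and L': "AE \<omega> in M. \<forall>s\<in>{-r..r}. 0 \<le> L s \<omega> \<and> ((\<lambda>s. L s \<omega>) has_real_derivative L s \<omega> * \<psi> s \<omega>) (at s)"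
    and \<psi>: "AE \<omega> in M. continuous_on {-r..r} (\<lambda>s. \<psi> s \<omega>)"
    and L1: "\<And>s. s \<in> {-r..r} \<Longrightarrow> (\<integral>\<^sup>+ \<omega>. ennreal (L s \<omega>) \<partial>M) = 1"
    and fisher: "\<And>s \<alpha> \<beta>. s \<in> {-r..r} \<Longrightarrow> (\<integral>\<^sup>+ \<omega>. ennreal (L s \<omega> * (\<psi> s \<omega> * \<alpha> + \<beta>)\<^sup>2) \<partial>M) \<le> ennreal (\<alpha>\<^sup>2 * J + \<beta>\<^sup>2)"
  shows "ennreal (2 * c) \<le> (\<integral>\<^sup>+ s. (\<integral>\<^sup>+ \<omega>. ennreal ((T \<omega> - s)\<^sup>2 * L s \<omega>) \<partial>M) \<partial>prior r) + ennreal (c\<^sup>2 * (J + 10 / r\<^sup>2))"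
proof -
  interpret prob_space M by fact
  interpret P: pair_sigma_finite lborel M by standard
  let ?g = "prior_root r" and ?g' = "prior_root' r" and ?I = "\<lambda>s. indicator {-r..r} s :: ennreal"
  have "ennreal (2 * c) = (\<integral>\<^sup>+ s. ennreal (2 * c) * (ennreal ((?g s)\<^sup>2) * ?I s) \<partial>lborel)"
    by (subst nn_integral_cmult) (auto simp: prior_root_sq_integral[OF r])
  also have "\<dots> = (\<integral>\<^sup>+ s. (\<integral>\<^sup>+ \<omega>. ennreal (2 * c * (L s \<omega> * (?g s)\<^sup>2)) * ?I s \<partial>M) \<partial>lborel)"
  proof (rule nn_integral_cong)
    fix s :: real
    have "(\<integral>\<^sup>+ \<omega>. ennreal (2 * c * (L s \<omega> * (?g s)\<^sup>2)) * ?I s \<partial>M)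
       = (\<integral>\<^sup>+ \<omega>. (ennreal (2 * c * (?g s)\<^sup>2) * ?I s) * ennreal (L s \<omega>) \<partial>M)"
    proof (rule nn_integral_cong)
      fix \<omega>
      have "ennreal (2 * c * (L s \<omega> * (?g s)\<^sup>2)) = ennreal (2 * c * (?g s)\<^sup>2) * ennreal (L s \<omega>)"
        using c by (subst ennreal_mult'[symmetric]) (auto simp: mult_ac)
      then show "ennreal (2 * c * (L s \<omega> * (?g s)\<^sup>2)) * ?I s = (ennreal (2 * c * (?g s)\<^sup>2) * ?I s) * ennreal (L s \<omega>)"
        by (simp add: mult_ac)
    qed
    also have "\<dots> = (ennreal (2 * c * (?g s)\<^sup>2) * ?I s) * (\<integral>\<^sup>+ \<omega>. ennreal (L s \<omega>) \<partial>M)"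
      by (rule nn_integral_cmult) measurable
    also have "\<dots> = ennreal (2 * c) * (ennreal ((?g s)\<^sup>2) * ?I s)"
      using L1[of s] c by (auto simp: indicator_def ennreal_mult)
    finally show "ennreal (2 * c) * (ennreal ((?g s)\<^sup>2) * ?I s) = (\<integral>\<^sup>+ \<omega>. ennreal (2 * c * (L s \<omega> * (?g s)\<^sup>2)) * ?I s \<partial>M)"
      by simp
  qed
  \<comment> \<open>The order is exchanged to apply the one-dimensional inequality for almost every
    \<omega>, and exchanged back to use the information bound at fixed s.\<close>
  also have "\<dots> = (\<integral>\<^sup>+ \<omega>. (\<integral>\<^sup>+ s. ennreal (2 * c * (L s \<omega> * (?g s)\<^sup>2)) * ?I s \<partial>lborel) \<partial>M)"
    by (rule P.Fubini'[symmetric]) measurable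
  also have "\<dots> \<le> (\<integral>\<^sup>+ \<omega>. (\<integral>\<^sup>+ s. ennreal ((T \<omega> - s)\<^sup>2 * L s \<omega> * (?g s)\<^sup>2
          + c\<^sup>2 * (L s \<omega> * (\<psi> s \<omega> * ?g s + 2 * ?g' s)\<^sup>2)) * ?I s \<partial>lborel) \<partial>M)"
    using L' \<psi> by (intro nn_integral_mono_AE) (auto intro!: van_trees_pointwise r c)
  also have "\<dots> = (\<integral>\<^sup>+ s. (\<integral>\<^sup>+ \<omega>. ennreal ((T \<omega> - s)\<^sup>2 * L s \<omega> * (?g s)\<^sup>2
          + c\<^sup>2 * (L s \<omega> * (\<psi> s \<omega> * ?g s + 2 * ?g' s)\<^sup>2)) * ?I s \<partial>M) \<partial>lborel)"
    by (rule P.Fubini') measurable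
  also have "\<dots> \<le> (\<integral>\<^sup>+ s. ennreal ((?g s)\<^sup>2) * (\<integral>\<^sup>+ \<omega>. ennreal ((T \<omega> - s)\<^sup>2 * L s \<omega>) \<partial>M) * ?I s
       + (ennreal (c\<^sup>2 * J) * (ennreal ((?g s)\<^sup>2) * ?I s) + ennreal (c\<^sup>2) * (ennreal ((2 * ?g' s)\<^sup>2) * ?I s)) \<partial>lborel)"
  proof (rule nn_integral_mono)
    fix s :: real
    show "(\<integral>\<^sup>+ \<omega>. ennreal ((T \<omega> - s)\<^sup>2 * L s \<omega> * (?g s)\<^sup>2
          + c\<^sup>2 * (L s \<omega> * (\<psi> s \<omega> * ?g s + 2 * ?g' s)\<^sup>2)) * ?I s \<partial>M)
        \<le> ennreal ((?g s)\<^sup>2) * (\<integral>\<^sup>+ \<omega>. ennreal ((T \<omega> - s)\<^sup>2 * L s \<omega>) \<partial>M) * ?I s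
          + (ennreal (c\<^sup>2 * J) * (ennreal ((?g s)\<^sup>2) * ?I s) + ennreal (c\<^sup>2) * (ennreal ((2 * ?g' s)\<^sup>2) * ?I s))"
    proof (cases "s \<in> {-r..r}")
      case True
      have "(\<integral>\<^sup>+ \<omega>. ennreal ((T \<omega> - s)\<^sup>2 * L s \<omega> * (?g s)\<^sup>2 + c\<^sup>2 * (L s \<omega> * (\<psi> s \<omega> * ?g s + 2 * ?g' s)\<^sup>2)) \<partial>M)
         = (\<integral>\<^sup>+ \<omega>. ennreal ((?g s)\<^sup>2) * ennreal ((T \<omega> - s)\<^sup>2 * L s \<omega>)
              + ennreal (c\<^sup>2) * ennreal (L s \<omega> * (\<psi> s \<omega> * ?g s + 2 * ?g' s)\<^sup>2) \<partial>M)"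
        using L' True by (intro nn_integral_cong_AE) (auto simp: ennreal_mult[symmetric] ennreal_plus[symmetric] mult_ac simp del: ennreal_plus)
      also have "\<dots> = ennreal ((?g s)\<^sup>2) * (\<integral>\<^sup>+ \<omega>. ennreal ((T \<omega> - s)\<^sup>2 * L s \<omega>) \<partial>M)
              + ennreal (c\<^sup>2) * (\<integral>\<^sup>+ \<omega>. ennreal (L s \<omega> * (\<psi> s \<omega> * ?g s + 2 * ?g' s)\<^sup>2) \<partial>M)"
        by (simp add: nn_integral_add nn_integral_cmult)
      \<comment> \<open>\<open>fisher\<close> with \<alpha> = g(s) and \<beta> = 2 g'(s): data score
        and prior score are orthogonal, so their informations add.\<close>
      also have "\<dots> \<le> ennreal ((?g s)\<^sup>2) * (\<integral>\<^sup>+ \<omega>. ennreal ((T \<omega> - s)\<^sup>2 * L s \<omega>) \<partial>M)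
              + ennreal (c\<^sup>2) * ennreal ((?g s)\<^sup>2 * J + (2 * ?g' s)\<^sup>2)"
        by (intro add_left_mono mult_left_mono fisher True) simp
      also have "ennreal (c\<^sup>2) * ennreal ((?g s)\<^sup>2 * J + (2 * ?g' s)\<^sup>2)
         = ennreal (c\<^sup>2 * J) * ennreal ((?g s)\<^sup>2) + ennreal (c\<^sup>2) * ennreal ((2 * ?g' s)\<^sup>2)"
        using J by (simp add: ennreal_mult[symmetric] ennreal_plus[symmetric] algebra_simps del: ennreal_plus)
      finally show ?thesis using True by simp
    qed simp
  qed
  also have "\<dots> = (\<integral>\<^sup>+ s. (\<integral>\<^sup>+ \<omega>. ennreal ((T \<omega> - s)\<^sup>2 * L s \<omega>) \<partial>M) \<partial>prior r)
      + (ennreal (c\<^sup>2 * J) * 1 + ennreal (c\<^sup>2) * ennreal (10 / r\<^sup>2))"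
    by (simp add: nn_integral_add nn_integral_cmult nn_integral_prior prior_root_sq_integral[OF r] prior_root'_sq_integral[OF r, simplified])
  also have "ennreal (c\<^sup>2 * J) * 1 + ennreal (c\<^sup>2) * ennreal (10 / r\<^sup>2) = ennreal (c\<^sup>2 * (J + 10 / r\<^sup>2))"
    using J by (simp add: ennreal_mult[symmetric] ennreal_plus[symmetric] distrib_left del: ennreal_plus)
  finally show ?thesis .
qed

section \<open>Lower bound for a fixed anchored law\<close>

lemma borel_measurable_vec_nth [measurable (raw)]:
  fixes f :: "'a \<Rightarrow> real^'n"
  assumes [measurable]: "f \<in> borel_measurable M"
  shows "(\<lambda>x. f x $ k) \<in> borel_measurable M"
  unfolding cart_eq_inner_axis by measurable

lemma power2_norm_vec: "(norm (x :: real^'n))\<^sup>2 = (\<Sum>k\<in>UNIV. (x $ k)\<^sup>2)"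
  unfolding power2_norm_eq_inner inner_vec_def by (simp add: power2_eq_square)

locale anchored_frame = simplex_frame H dd for H :: "real^'m^'d" and dd :: real +
  fixes \<rho> :: "(real^'m) measure"
  assumes rho: "\<rho> \<in> anchored H"
begin

sublocale prob_space \<rho>
  using rho by (simp add: anchored_def)

lemma sets_rho [measurable_cong, simp]: "sets \<rho> = sets borel"
  using rho by (simp add: anchored_def)

lemma space_rho [simp]: "space \<rho> = UNIV"
  using sets_eq_imp_space_eq[OF sets_rho] by simp

lemma AE_Xd: "AE x in \<rho>. x \<in> Xd H"
  using rho by (simp add: anchored_def)

lemma integrable_bounded_Xd:
  fixes f :: "real^'m \<Rightarrow> 'b::{banach, second_countable_topology}"
  assumes [measurable]: "f \<in> borel_measurable borel" and le: "\<And>x. x \<in> Xd H \<Longrightarrow> norm (f x) \<le> B"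
  shows "integrable \<rho> f"
  by (rule integrable_const_bound[where B = B]) (use AE_Xd le in auto)

lemma integral_inner_rho: "(\<integral>x. h \<bullet> x \<partial>\<rho>) = 0"
proof -
  have "integrable \<rho> (\<lambda>x. x)"
    by (rule integrable_bounded_Xd[where B = "dd\<^sup>2"]) (auto intro: Xd_norm_le)
  then have "(\<integral>x. h \<bullet> x \<partial>\<rho>) = h \<bullet> (\<integral>x. x \<partial>\<rho>)"
    by (rule integral_inner_right)
  then show ?thesis using rho by (simp add: anchored_def)
qed

lemma integrable_inner_rho: "integrable \<rho> (\<lambda>x. h \<bullet> x)"
proof (rule integrable_bounded_Xd)
  fix x assume "x \<in> Xd H"
  then show "norm (h \<bullet> x) \<le> norm h * dd\<^sup>2"
    using Cauchy_Schwarz_ineq2[of h x] mult_left_mono[OF Xd_norm_le[of x], of "norm h"] by auto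
qed simp

section \<open>Change of measure to the model with parameter h\<close>

definition tilt :: "real^'m \<Rightarrow> (real^'m) measure" where
  "tilt h = density \<rho> (\<lambda>x. ennreal (1 + h \<bullet> x))"

lemma q_law_eq_tilt: "q_law H \<theta> \<rho> = tilt (hth H \<theta>)"
  by (simp add: q_law_def tilt_def)

lemma sets_tilt [measurable_cong, simp]: "sets (tilt h) = sets borel"
  by (simp add: tilt_def)

lemma prob_space_tilt:
  assumes nn: "\<And>x. x \<in> Xd H \<Longrightarrow> 0 \<le> 1 + h \<bullet> x"
  shows "prob_space (tilt h)"
proof (rule prob_spaceI)
  have "emeasure (tilt h) (space (tilt h)) = (\<integral>\<^sup>+ x. ennreal (1 + h \<bullet> x) \<partial>\<rho>)"
    by (simp add: tilt_def emeasure_density)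
  also have "\<dots> = ennreal (\<integral>x. 1 + h \<bullet> x \<partial>\<rho>)"
    using AE_Xd nn by (intro nn_integral_eq_integral) (auto intro: integrable_inner_rho)
  also have "(\<integral>x. 1 + h \<bullet> x \<partial>\<rho>) = 1"
    by (simp add: integrable_inner_rho integral_inner_rho prob_space[simplified])
  finally show "emeasure (tilt h) (space (tilt h)) = 1" by simp
qed

lemma AE_PiM_Xd: "AE \<omega> in PiM {..<n::nat} (\<lambda>_. \<rho>). \<forall>m<n. \<omega> m \<in> Xd H"
proof -
  have "AE \<omega> in PiM {..<n::nat} (\<lambda>_. \<rho>). \<forall>m\<in>{..<n}. \<omega> m \<in> Xd H"
    by (intro AE_finite_allI) (auto intro: AE_PiM_component AE_Xd prob_space_axioms)
  then show ?thesis by eventually_elim simp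
qed

lemma nn_integral_PiM_tilt:
  assumes nn: "\<And>x. x \<in> Xd H \<Longrightarrow> 0 \<le> 1 + h \<bullet> x"
    and [measurable]: "F \<in> borel_measurable (PiM {..<n::nat} (\<lambda>_. borel))"
  shows "(\<integral>\<^sup>+ \<omega>. F \<omega> \<partial>PiM {..<n} (\<lambda>_. tilt h))
    = (\<integral>\<^sup>+ \<omega>. ennreal (\<Prod>m<n. 1 + h \<bullet> \<omega> m) * F \<omega> \<partial>PiM {..<n} (\<lambda>_. \<rho>))"
proof -
  have [measurable]: "F \<in> borel_measurable (PiM {..<n} (\<lambda>_. \<rho>))"
    using sets_PiM_cong[OF refl, of "{..<n}" "\<lambda>_. \<rho>" "\<lambda>_. borel"] by (simp cong: measurable_cong_sets)
  have "PiM {..<n} (\<lambda>_. tilt h) = density (PiM {..<n} (\<lambda>_. \<rho>)) (\<lambda>\<omega>. \<Prod>m<n. ennreal (1 + h \<bullet> \<omega> m))"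
    unfolding tilt_def using prob_space_tilt[OF nn]
    by (intro PiM_density_same prob_space_axioms) (auto simp: tilt_def)
  then have "(\<integral>\<^sup>+ \<omega>. F \<omega> \<partial>PiM {..<n} (\<lambda>_. tilt h))
     = (\<integral>\<^sup>+ \<omega>. (\<Prod>m<n. ennreal (1 + h \<bullet> \<omega> m)) * F \<omega> \<partial>PiM {..<n} (\<lambda>_. \<rho>))"
    by (simp add: nn_integral_density)
  \<comment> \<open>Only an almost-everywhere identity: off \<open>Xd H\<close> factors may be
    negative, and \<open>ennreal\<close> would truncate them one by one on one side and as a product
    on the other.\<close>
  also have "\<dots> = (\<integral>\<^sup>+ \<omega>. ennreal (\<Prod>m<n. 1 + h \<bullet> \<omega> m) * F \<omega> \<partial>PiM {..<n} (\<lambda>_. \<rho>))"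
  proof (rule nn_integral_cong_AE)
    show "AE \<omega> in PiM {..<n} (\<lambda>_. \<rho>). (\<Prod>m<n. ennreal (1 + h \<bullet> \<omega> m)) * F \<omega> = ennreal (\<Prod>m<n. 1 + h \<bullet> \<omega> m) * F \<omega>"
      using AE_PiM_Xd[of n] by eventually_elim (subst prod_ennreal, auto intro: nn)
  qed
  finally show ?thesis .
qed

lemma integral_tilt:
  fixes f :: "real^'m \<Rightarrow> real"
  assumes nn: "\<And>x. x \<in> Xd H \<Longrightarrow> 0 \<le> 1 + h \<bullet> x" and [measurable]: "f \<in> borel_measurable borel"
  shows "(\<integral>x. f x \<partial>tilt h) = (\<integral>x. (1 + h \<bullet> x) * f x \<partial>\<rho>)"
    and "integrable (tilt h) f \<longleftrightarrow> integrable \<rho> (\<lambda>x. (1 + h \<bullet> x) * f x)"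
proof -
  have "AE x in \<rho>. 0 \<le> 1 + h \<bullet> x" using AE_Xd nn by auto
  then show "(\<integral>x. f x \<partial>tilt h) = (\<integral>x. (1 + h \<bullet> x) * f x \<partial>\<rho>)"
    "integrable (tilt h) f \<longleftrightarrow> integrable \<rho> (\<lambda>x. (1 + h \<bullet> x) * f x)"
    unfolding tilt_def by (simp_all add: integral_density integrable_density)
qed

text \<open>The score in direction k is the sum of x_k / (1 + h \<bullet> x) over the sample.
  Weighted by the density 1 + h \<bullet> x, a summand becomes x_k, which has mean zero under
  \<rho>, and its square becomes x_k^2 / (1 + h \<bullet> x) \<le> x_k^2 / (1 - \<eta>). The
  variance formula with shift \<beta> then gives the exact shape of the hypothesis
  \<open>fisher\<close>.\<close>

lemma fisher_information_le:
  assumes \<eta>: "\<eta> < 1" and h: "\<And>x. x \<in> Xd H \<Longrightarrow> \<bar>h \<bullet> x\<bar> \<le> \<eta>"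
  shows "(\<integral>\<^sup>+ \<omega>. ennreal ((\<Prod>m<n. 1 + h \<bullet> \<omega> m) * ((\<Sum>m<n. \<omega> m $ k / (1 + h \<bullet> \<omega> m)) * \<alpha> + \<beta>)\<^sup>2) \<partial>PiM {..<n} (\<lambda>_. \<rho>))
    \<le> ennreal (\<alpha>\<^sup>2 * (real n * (\<integral>x. (x $ k)\<^sup>2 \<partial>\<rho>) / (1 - \<eta>)) + \<beta>\<^sup>2)"
proof -
  define f where "f x = \<alpha> * (x $ k) / (1 + h \<bullet> x)" for x
  have [measurable]: "f \<in> borel_measurable borel" unfolding f_def by measurable
  have ge: "1 - \<eta> \<le> 1 + h \<bullet> x" if "x \<in> Xd H" for x using h[OF that] by linarith
  then have pos: "0 < 1 + h \<bullet> x" if "x \<in> Xd H" for x using that \<eta> by fastforce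
  then have nn: "0 \<le> 1 + h \<bullet> x" if "x \<in> Xd H" for x using that by (simp add: less_imp_le)
  have nth_le: "\<bar>x $ k\<bar> \<le> dd\<^sup>2" if "x \<in> Xd H" for x
    using component_le_norm_cart[of x k] Xd_norm_le[OF that] by simp
  have int_nth: "integrable \<rho> (\<lambda>x. x $ k)" "(\<integral>x. x $ k \<partial>\<rho>) = 0"
    using integrable_inner_rho[of "axis k 1"] integral_inner_rho[of "axis k 1"]
    by (simp_all add: inner_axis inner_commute[of "axis k 1"])
  have int_nth2: "integrable \<rho> (\<lambda>x. (x $ k)\<^sup>2)"
  proof (rule integrable_bounded_Xd)
    fix x assume "x \<in> Xd H"
    then show "norm ((x $ k)\<^sup>2) \<le> (dd\<^sup>2)\<^sup>2"
      using power_mono[OF nth_le abs_ge_zero, of x 2] by simp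
  qed simp
  have f1: "AE x in \<rho>. (1 + h \<bullet> x) * f x = \<alpha> * x $ k"
    using AE_Xd
  proof eventually_elim
    case (elim x)
    then show ?case using pos[OF elim] by (simp add: f_def)
  qed
  have f2: "AE x in \<rho>. (1 + h \<bullet> x) * (f x)\<^sup>2 \<le> \<alpha>\<^sup>2 / (1 - \<eta>) * (x $ k)\<^sup>2"
    using AE_Xd
  proof eventually_elim
    case (elim x)
    have "(1 + h \<bullet> x) * (f x)\<^sup>2 = (\<alpha> * x $ k)\<^sup>2 / (1 + h \<bullet> x)"
      using pos[OF elim] by (simp add: f_def power2_eq_square)
    also have "\<dots> \<le> (\<alpha> * x $ k)\<^sup>2 / (1 - \<eta>)"
      using ge[OF elim] \<eta> by (intro divide_left_mono) auto
    finally show ?case by (simp add: power_mult_distrib)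
  qed
  have int_f2: "integrable \<rho> (\<lambda>x. (1 + h \<bullet> x) * (f x)\<^sup>2)"
  proof (rule Bochner_Integration.integrable_bound)
    show "integrable \<rho> (\<lambda>x. \<alpha>\<^sup>2 / (1 - \<eta>) * (x $ k)\<^sup>2)" by (intro integrable_mult_right int_nth2)
    show "AE x in \<rho>. norm ((1 + h \<bullet> x) * (f x)\<^sup>2) \<le> norm (\<alpha>\<^sup>2 / (1 - \<eta>) * (x $ k)\<^sup>2)"
      using f2 AE_Xd by eventually_elim (use nn \<eta> in \<open>auto simp: abs_mult\<close>)
  qed simp
  have int_f1: "integrable \<rho> (\<lambda>x. (1 + h \<bullet> x) * f x)"
    by (subst integrable_cong_AE[OF _ _ f1]) (auto intro: int_nth)
  have "(\<integral>\<^sup>+ \<omega>. ennreal ((\<Prod>m<n. 1 + h \<bullet> \<omega> m) * ((\<Sum>m<n. \<omega> m $ k / (1 + h \<bullet> \<omega> m)) * \<alpha> + \<beta>)\<^sup>2) \<partial>PiM {..<n} (\<lambda>_. \<rho>))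
      = (\<integral>\<^sup>+ \<omega>. ennreal (\<Prod>m<n. 1 + h \<bullet> \<omega> m) * ennreal ((\<beta> + (\<Sum>m<n. f (\<omega> m)))\<^sup>2) \<partial>PiM {..<n} (\<lambda>_. \<rho>))"
  proof (rule nn_integral_cong)
    fix \<omega> :: "nat \<Rightarrow> real^'m"
    have "(\<Sum>m<n. \<omega> m $ k / (1 + h \<bullet> \<omega> m)) * \<alpha> = (\<Sum>m<n. f (\<omega> m))"
      unfolding f_def sum_distrib_right by (intro sum.cong) auto
    then show "ennreal ((\<Prod>m<n. 1 + h \<bullet> \<omega> m) * ((\<Sum>m<n. \<omega> m $ k / (1 + h \<bullet> \<omega> m)) * \<alpha> + \<beta>)\<^sup>2)
      = ennreal (\<Prod>m<n. 1 + h \<bullet> \<omega> m) * ennreal ((\<beta> + (\<Sum>m<n. f (\<omega> m)))\<^sup>2)"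
      by (simp add: ennreal_mult''[symmetric] add.commute)
  qed
  also have "\<dots> = (\<integral>\<^sup>+ \<omega>. ennreal ((\<beta> + (\<Sum>m<n. f (\<omega> m)))\<^sup>2) \<partial>PiM {..<n} (\<lambda>_. tilt h))"
    by (rule nn_integral_PiM_tilt[OF nn, symmetric]) auto
  also have "\<dots> = ennreal (\<beta>\<^sup>2 + real n * (\<integral>x. (f x)\<^sup>2 \<partial>tilt h))"
  proof (rule nn_integral_PiM_sum_sq)
    show "prob_space (tilt h)" by (rule prob_space_tilt[OF nn])
    show "integrable (tilt h) f" using int_f1 by (simp add: integral_tilt[OF nn])
    show "integrable (tilt h) (\<lambda>x. (f x)\<^sup>2)" using int_f2 by (simp add: integral_tilt[OF nn])
    show "(\<integral>x. f x \<partial>tilt h) = 0"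
      using integral_cong_AE[OF _ _ f1] by (simp add: integral_tilt[OF nn] int_nth)
  qed simp
  also have "\<dots> \<le> ennreal (\<alpha>\<^sup>2 * (real n * (\<integral>x. (x $ k)\<^sup>2 \<partial>\<rho>) / (1 - \<eta>)) + \<beta>\<^sup>2)"
  proof (rule ennreal_leI)
    have "(\<integral>x. (f x)\<^sup>2 \<partial>tilt h) \<le> (\<integral>x. \<alpha>\<^sup>2 / (1 - \<eta>) * (x $ k)\<^sup>2 \<partial>\<rho>)"
      unfolding integral_tilt(1)[OF nn, of "\<lambda>x. (f x)\<^sup>2", simplified]
      by (intro integral_mono_AE int_f2 f2 integrable_mult_right int_nth2)
    then have "real n * (\<integral>x. (f x)\<^sup>2 \<partial>tilt h) \<le> real n * (\<alpha>\<^sup>2 / (1 - \<eta>) * (\<integral>x. (x $ k)\<^sup>2 \<partial>\<rho>))"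
      by (intro mult_left_mono) auto
    then show "\<beta>\<^sup>2 + real n * (\<integral>x. (f x)\<^sup>2 \<partial>tilt h) \<le> \<alpha>\<^sup>2 * (real n * (\<integral>x. (x $ k)\<^sup>2 \<partial>\<rho>) / (1 - \<eta>)) + \<beta>\<^sup>2"
      by (simp add: mult_ac)
  qed
  finally show ?thesis .
qed

text \<open>Written with a likelihood over a fixed base measure, not as an integral over
  \<open>tilt h\<close>: this makes measurability in \<open>h\<close> immediate and matches the risk
  term of \<open>van_trees\<close>.\<close>

definition coord_risk :: "nat \<Rightarrow> ((nat \<Rightarrow> real^'m) \<Rightarrow> real^'m) \<Rightarrow> 'm \<Rightarrow> real^'m \<Rightarrow> ennreal" where
  "coord_risk n T k h = (\<integral>\<^sup>+ \<omega>. ennreal ((T \<omega> $ k - h $ k)\<^sup>2 * (\<Prod>m<n. 1 + h \<bullet> \<omega> m)) \<partial>PiM {..<n} (\<lambda>_. \<rho>))"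

text \<open>van Trees along the line through \<open>h0\<close> in direction k. The factors of the
  likelihood are affine in s and nonzero on the segment, so the logarithmic derivative is the sum
  \<psi>; \<open>h0 $ k = 0\<close> makes s itself the k-th coordinate being estimated.\<close>

lemma coord_risk_ge:
  assumes r: "0 < r" and c: "0 \<le> c" and \<eta>: "\<eta> < 1"
    and T [measurable]: "T \<in> borel_measurable (PiM {..<n} (\<lambda>_. borel))"
    and h: "\<And>s x. s \<in> {-r..r} \<Longrightarrow> x \<in> Xd H \<Longrightarrow> \<bar>(h0 + s *\<^sub>R axis k 1) \<bullet> x\<bar> \<le> \<eta>"
    and h0: "h0 $ k = 0"
  shows "ennreal (2 * c) \<le> (\<integral>\<^sup>+ s. coord_risk n T k (h0 + s *\<^sub>R axis k 1) \<partial>prior r)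
      + ennreal (c\<^sup>2 * (real n * (\<integral>x. (x $ k)\<^sup>2 \<partial>\<rho>) / (1 - \<eta>) + 10 / r\<^sup>2))"
proof -
  define hs where "hs s = h0 + s *\<^sub>R axis k (1::real)" for s
  define M where "M = PiM {..<n} (\<lambda>_. \<rho>)"
  define L where "L s \<omega> = (\<Prod>m<n. 1 + hs s \<bullet> \<omega> m)" for s \<omega>
  define \<psi> where "\<psi> s \<omega> = (\<Sum>m<n. \<omega> m $ k / (1 + hs s \<bullet> \<omega> m))" for s \<omega>
  have [measurable]: "T \<in> borel_measurable M"
    unfolding M_def using sets_PiM_cong[OF refl, of "{..<n}" "\<lambda>_. \<rho>" "\<lambda>_. borel"] T by (simp cong: measurable_cong_sets)
  have pos: "0 < 1 + hs s \<bullet> x" if "s \<in> {-r..r}" "x \<in> Xd H" for s x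
    using h[OF that] \<eta> by (simp add: hs_def abs_le_iff)
  have hs_lin: "hs s \<bullet> x = h0 \<bullet> x + s * x $ k" for s x
    by (simp add: hs_def inner_add_left inner_axis inner_commute[of "axis k 1"])
  have hs_k: "hs s $ k = s" for s by (simp add: hs_def h0)
  have "ennreal (2 * c) \<le> (\<integral>\<^sup>+ s. (\<integral>\<^sup>+ \<omega>. ennreal ((T \<omega> $ k - s)\<^sup>2 * L s \<omega>) \<partial>M) \<partial>prior r)
      + ennreal (c\<^sup>2 * (real n * (\<integral>x. (x $ k)\<^sup>2 \<partial>\<rho>) / (1 - \<eta>) + 10 / r\<^sup>2))"
  proof (rule van_trees[where \<psi> = \<psi> and L = L and T = "\<lambda>\<omega>. T \<omega> $ k"])
    show "prob_space M" unfolding M_def by (intro prob_space_PiM prob_space_axioms)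
    show "0 \<le> real n * (\<integral>x. (x $ k)\<^sup>2 \<partial>\<rho>) / (1 - \<eta>)"
      using \<eta> by (intro divide_nonneg_nonneg mult_nonneg_nonneg integral_nonneg) auto
    show "case_prod L \<in> borel_measurable (borel \<Otimes>\<^sub>M M)"
      unfolding L_def M_def hs_def by measurable
    show "case_prod \<psi> \<in> borel_measurable (borel \<Otimes>\<^sub>M M)"
      unfolding \<psi>_def M_def hs_def by measurable
    show "AE \<omega> in M. \<forall>s\<in>{-r..r}. 0 \<le> L s \<omega> \<and> ((\<lambda>s. L s \<omega>) has_real_derivative L s \<omega> * \<psi> s \<omega>) (at s)"
      unfolding M_def using AE_PiM_Xd[of n]
    proof eventually_elim
      case (elim \<omega>)
      show ?case
      proof (intro ballI conjI)
        fix s assume s: "s \<in> {-r..r}"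
        show "0 \<le> L s \<omega>" unfolding L_def using elim pos[OF s] by (intro prod_nonneg) (auto intro: less_imp_le)
        show "((\<lambda>s. L s \<omega>) has_real_derivative L s \<omega> * \<psi> s \<omega>) (at s)"
          unfolding L_def \<psi>_def
        proof (rule has_field_derivative_prod')
          fix m assume "m \<in> {..<n}"
          then show "1 + hs s \<bullet> \<omega> m \<noteq> 0" using elim pos[OF s, of "\<omega> m"] by auto
          show "((\<lambda>s. 1 + hs s \<bullet> \<omega> m) has_real_derivative \<omega> m $ k) (at s)"
            unfolding hs_lin by (auto intro!: derivative_eq_intros)
        qed
      qed
    qed
    show "AE \<omega> in M. continuous_on {-r..r} (\<lambda>s. \<psi> s \<omega>)"
      unfolding M_def using AE_PiM_Xd[of n]
    proof eventually_elim
      case (elim \<omega>)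
      show ?case unfolding \<psi>_def
      proof (intro continuous_on_sum continuous_on_divide)
        fix m assume m: "m \<in> {..<n}"
        show "continuous_on {-r..r} (\<lambda>s. 1 + hs s \<bullet> \<omega> m)"
          unfolding hs_lin by (intro continuous_intros)
        show "\<forall>s\<in>{-r..r}. 1 + hs s \<bullet> \<omega> m \<noteq> 0"
          using pos[of _ "\<omega> m"] elim m by fastforce
      qed simp
    qed
    fix s assume s: "s \<in> {-r..r}"
    interpret Q: prob_space "PiM {..<n} (\<lambda>_. tilt (hs s))"
      using pos[OF s] by (intro prob_space_PiM prob_space_tilt) (auto intro: less_imp_le)
    show "(\<integral>\<^sup>+ \<omega>. ennreal (L s \<omega>) \<partial>M) = 1"
      using nn_integral_PiM_tilt[of "hs s" "\<lambda>_. 1" n] pos[OF s]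
      by (simp add: L_def M_def less_imp_le Q.emeasure_space_1)
    show "(\<integral>\<^sup>+ \<omega>. ennreal (L s \<omega> * (\<psi> s \<omega> * \<alpha> + \<beta>)\<^sup>2) \<partial>M)
        \<le> ennreal (\<alpha>\<^sup>2 * (real n * (\<integral>x. (x $ k)\<^sup>2 \<partial>\<rho>) / (1 - \<eta>)) + \<beta>\<^sup>2)" for \<alpha> \<beta>
      unfolding L_def \<psi>_def M_def
      by (rule fisher_information_le[OF \<eta>]) (use h[OF s] in \<open>auto simp: hs_def\<close>)
  qed (use r c in auto)
  then show ?thesis
    by (simp only: coord_risk_def L_def M_def hs_k hs_def[symmetric])
qed

end

text \<open>Clamping keeps the parameter in the cube for every \<open>u\<close>, not just almost every \<open>u\<close> under the
  product prior, so the coordinate-wise bound can be applied with the other coordinates fixed.\<close>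

definition clamp_vec :: "real \<Rightarrow> ('m::finite \<Rightarrow> real) \<Rightarrow> real^'m" where
  "clamp_vec r u = (\<Sum>k\<in>UNIV. max (- r) (min r (u k)) *\<^sub>R axis k 1)"

lemma norm_clamp_vec_le:
  fixes u :: "'m::finite \<Rightarrow> real"
  assumes "0 \<le> r"
  shows "norm (clamp_vec r u) \<le> real CARD('m) * r"
proof -
  have "norm (clamp_vec r u) \<le> (\<Sum>k\<in>UNIV. norm (max (- r) (min r (u k)) *\<^sub>R (axis k 1 :: real^'m)))"
    unfolding clamp_vec_def by (rule norm_sum)
  also have "\<dots> \<le> (\<Sum>k\<in>(UNIV::'m set). r)"
    using assms by (intro sum_mono) (auto simp: norm_axis_1)
  finally show ?thesis by simp
qed

lemma clamp_vec_nth: "clamp_vec r u $ k = max (- r) (min r (u k))"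
  by (simp add: clamp_vec_def axis_def if_distrib cong: if_cong)

lemma clamp_vec_upd:
  assumes "s \<in> {-r..r}"
  shows "clamp_vec r (fun_upd u k s) = clamp_vec r (fun_upd u k 0) + s *\<^sub>R axis k 1"
  using assms by (auto simp: vec_eq_iff clamp_vec_nth axis_def)

section \<open>Bayes risk under the product prior\<close>

context anchored_frame begin

lemma transpose_estimator_measurable:
  assumes "est \<in> estimators n"
  shows "(\<lambda>\<omega>. transpose H *v est \<omega>) \<in> borel_measurable (PiM {..<n} (\<lambda>_. borel))"
proof -
  have "(\<lambda>y. transpose H *v y) \<in> borel_measurable borel"
    by (intro borel_measurable_continuous_onI linear_continuous_on matrix_vector_mul_bounded_linear)
  then show ?thesis
    using assms measurable_compose[of est "PiM {..<n} (\<lambda>_. borel)" borel] by (simp add: estimators_def)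
qed

lemma coord_risk_measurable:
  assumes [measurable]: "T \<in> borel_measurable (PiM {..<n} (\<lambda>_. borel))"
    and [measurable]: "h \<in> borel_measurable N"
  shows "(\<lambda>u. coord_risk n T k (h u)) \<in> borel_measurable N"
proof -
  interpret PP: prob_space "PiM {..<n} (\<lambda>_. \<rho>)"
    by (intro prob_space_PiM prob_space_axioms)
  have [measurable]: "T \<in> borel_measurable (PiM {..<n} (\<lambda>_. \<rho>))"
    using sets_PiM_cong[OF refl, of "{..<n}" "\<lambda>_. \<rho>" "\<lambda>_. borel"] assms(1) by (simp cong: measurable_cong_sets)
  show ?thesis unfolding coord_risk_def by measurable
qed

text \<open>Coordinate k is integrated first, with the others frozen, so
  \<open>coord_risk_ge\<close> applies for each fixed choice of them. The condition on r comes from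
  |h| \<le> d r on the cube and |x| \<le> d^2 on \<open>Xd H\<close>.\<close>

lemma average_coord_risk_ge:
  assumes r: "0 < r" and c: "0 \<le> c" and \<eta>: "\<eta> < 1" and r\<eta>: "dd * r * dd\<^sup>2 \<le> \<eta>"
    and T: "T \<in> borel_measurable (PiM {..<n} (\<lambda>_. borel))"
  shows "ennreal (2 * c) \<le> (\<integral>\<^sup>+ u. coord_risk n T k (clamp_vec r u) \<partial>PiM UNIV (\<lambda>_. prior r))
      + ennreal (c\<^sup>2 * (real n * (\<integral>x. (x $ k)\<^sup>2 \<partial>\<rho>) / (1 - \<eta>) + 10 / r\<^sup>2))"
proof -
  define A where "A = ennreal (c\<^sup>2 * (real n * (\<integral>x. (x $ k)\<^sup>2 \<partial>\<rho>) / (1 - \<eta>) + 10 / r\<^sup>2))"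
  define M where "M = PiM (UNIV - {k}) (\<lambda>_::'m. prior r)"
  have prior: "prob_space (prior r)" by (rule prob_space_prior[OF r])
  interpret product_prob_space "\<lambda>_::'m. prior r" using prior by (simp add: product_prob_spaceI)
  interpret PM: prob_space M unfolding M_def by (intro prob_space_PiM prior)
  have [measurable]: "(\<lambda>u. clamp_vec r u) \<in> borel_measurable (PiM UNIV (\<lambda>_::'m. prior r))"
    unfolding clamp_vec_def by measurable
  have eq: "(\<integral>\<^sup>+ u. coord_risk n T k (clamp_vec r u) \<partial>PiM UNIV (\<lambda>_. prior r))
      = (\<integral>\<^sup>+ u. (\<integral>\<^sup>+ s. coord_risk n T k (clamp_vec r (fun_upd u k s)) \<partial>prior r) \<partial>M)"
    unfolding M_def using product_nn_integral_insert[of "UNIV - {k}" k "\<lambda>u. coord_risk n T k (clamp_vec r u)"]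
    by (simp add: insert_UNIV coord_risk_measurable[OF T])
  have AE: "AE s in prior r. s \<in> {-r..r}"
    unfolding prior_def by (subst AE_density) (auto simp: indicator_def)
  have le: "ennreal (2 * c) \<le> (\<integral>\<^sup>+ s. coord_risk n T k (clamp_vec r (fun_upd u k s)) \<partial>prior r) + A" for u
  proof -
    have "ennreal (2 * c) \<le> (\<integral>\<^sup>+ s. coord_risk n T k (clamp_vec r (fun_upd u k 0) + s *\<^sub>R axis k 1) \<partial>prior r) + A"
      unfolding A_def
    proof (rule coord_risk_ge[OF r c \<eta> T])
      fix s x assume s: "s \<in> {-r..r}" and x: "x \<in> Xd H"
      have "\<bar>clamp_vec r (fun_upd u k s) \<bullet> x\<bar> \<le> norm (clamp_vec r (fun_upd u k s)) * norm x"
        by (rule Cauchy_Schwarz_ineq2)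
      also have "\<dots> \<le> (real CARD('m) * r) * dd\<^sup>2"
        using r by (intro mult_mono norm_clamp_vec_le Xd_norm_le[OF x]) auto
      also have "\<dots> \<le> dd * r * dd\<^sup>2"
        using r by (intro mult_right_mono) (auto simp: card_m)
      finally show "\<bar>(clamp_vec r (fun_upd u k 0) + s *\<^sub>R axis k 1) \<bullet> x\<bar> \<le> \<eta>"
        using r\<eta> by (simp only: clamp_vec_upd[OF s])
    qed (use r in \<open>simp add: clamp_vec_nth\<close>)
    \<comment> \<open>The updated coordinate is clamped as well, which is harmless because the prior
      lives on [-r, r].\<close>
    also have "(\<integral>\<^sup>+ s. coord_risk n T k (clamp_vec r (fun_upd u k 0) + s *\<^sub>R axis k 1) \<partial>prior r)
       = (\<integral>\<^sup>+ s. coord_risk n T k (clamp_vec r (fun_upd u k s)) \<partial>prior r)"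
    proof (rule nn_integral_cong_AE)
      show "AE s in prior r. coord_risk n T k (clamp_vec r (fun_upd u k 0) + s *\<^sub>R axis k 1)
          = coord_risk n T k (clamp_vec r (fun_upd u k s))"
        using AE by eventually_elim (simp only: clamp_vec_upd)
    qed
    finally show ?thesis .
  qed
  have "ennreal (2 * c) = (\<integral>\<^sup>+ u. ennreal (2 * c) \<partial>M)"
    by (simp add: PM.emeasure_space_1)
  also have "\<dots> \<le> (\<integral>\<^sup>+ u. (\<integral>\<^sup>+ s. coord_risk n T k (clamp_vec r (fun_upd u k s)) \<partial>prior r) + A \<partial>M)"
    by (intro nn_integral_mono le)
  also have "\<dots> = (\<integral>\<^sup>+ u. (\<integral>\<^sup>+ s. coord_risk n T k (clamp_vec r (fun_upd u k s)) \<partial>prior r) \<partial>M) + (\<integral>\<^sup>+ u. A \<partial>M)"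
  proof (rule nn_integral_add)
    have upd: "(\<lambda>(u, s). fun_upd u k s) \<in> measurable (M \<Otimes>\<^sub>M prior r) (PiM UNIV (\<lambda>_. prior r))"
      unfolding M_def using measurable_add_dim[of k "UNIV - {k}" "\<lambda>_. prior r"] by (simp add: insert_UNIV)
    have "(\<lambda>us. coord_risk n T k (clamp_vec r ((\<lambda>(u, s). fun_upd u k s) us))) \<in> borel_measurable (M \<Otimes>\<^sub>M prior r)"
      by (intro coord_risk_measurable[OF T] measurable_compose[OF upd]) measurable
    then show "(\<lambda>u. \<integral>\<^sup>+ s. coord_risk n T k (clamp_vec r (fun_upd u k s)) \<partial>prior r) \<in> borel_measurable M"
      by (intro sigma_finite_measure.borel_measurable_nn_integral prob_space_imp_sigma_finite prior)
         (simp add: case_prod_unfold)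
  qed simp
  also have "(\<integral>\<^sup>+ u. A \<partial>M) = A" by (simp add: PM.emeasure_space_1)
  finally show ?thesis by (simp only: eq A_def)
qed

text \<open>The parameter h lifts to the simplex point \<theta> = 1/d + H h, and H^T
  \<open>est\<close> - h = H^T (\<open>est\<close> - \<theta>). As H^T does not increase norms, the
  risk of the projected estimator is at most the risk at \<theta>.\<close>

lemma sum_coord_risk_le:
  assumes est: "est \<in> estimators n" and h: "norm h \<le> 1 / dd"
    and nn: "\<And>x. x \<in> Xd H \<Longrightarrow> 0 \<le> 1 + h \<bullet> x"
  shows "(\<Sum>k\<in>UNIV. coord_risk n (\<lambda>\<omega>. transpose H *v est \<omega>) k h) \<le> worst_risk H n \<rho> est"
proof -
  define \<theta> where "\<theta> = (\<chi> i. 1 / dd) + H *v h"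
  define T where "T \<omega> = transpose H *v est \<omega>" for \<omega>
  define M where "M = PiM {..<n} (\<lambda>_. \<rho>)"
  have \<theta>: "\<theta> \<in> prob_simplex" "hth H \<theta> = h"
    unfolding \<theta>_def by (rule lift_simplex[OF h], rule hth_lift)
  have T0 [measurable]: "T \<in> borel_measurable (PiM {..<n} (\<lambda>_. borel))"
    unfolding T_def by (rule transpose_estimator_measurable[OF est])
  have [measurable]: "T \<in> borel_measurable M"
    unfolding M_def using sets_PiM_cong[OF refl, of "{..<n}" "\<lambda>_. \<rho>" "\<lambda>_. borel"] T0 by (simp cong: measurable_cong_sets)
  have "(\<Sum>k\<in>UNIV. coord_risk n T k h)
     = (\<integral>\<^sup>+ \<omega>. (\<Sum>k\<in>UNIV. ennreal ((T \<omega> $ k - h $ k)\<^sup>2 * (\<Prod>m<n. 1 + h \<bullet> \<omega> m))) \<partial>M)"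
    unfolding coord_risk_def M_def[symmetric]
    by (rule nn_integral_sum[symmetric]) (auto simp: M_def intro!: measurable_compose[OF _ measurable_ennreal])
  also have "\<dots> = (\<integral>\<^sup>+ \<omega>. ennreal (\<Prod>m<n. 1 + h \<bullet> \<omega> m) * ennreal ((norm (T \<omega> - h))\<^sup>2) \<partial>M)"
  proof (rule nn_integral_cong)
    fix \<omega>
    have "(\<Sum>k\<in>UNIV. ennreal ((T \<omega> $ k - h $ k)\<^sup>2 * (\<Prod>m<n. 1 + h \<bullet> \<omega> m)))
       = (\<Sum>k\<in>UNIV. ennreal ((T \<omega> $ k - h $ k)\<^sup>2)) * ennreal (\<Prod>m<n. 1 + h \<bullet> \<omega> m)"
      unfolding sum_distrib_right by (intro sum.cong refl) (simp add: ennreal_mult')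
    also have "(\<Sum>k\<in>UNIV. ennreal ((T \<omega> $ k - h $ k)\<^sup>2)) = ennreal ((norm (T \<omega> - h))\<^sup>2)"
      by (subst sum_ennreal) (auto simp: power2_norm_vec)
    finally show "(\<Sum>k\<in>UNIV. ennreal ((T \<omega> $ k - h $ k)\<^sup>2 * (\<Prod>m<n. 1 + h \<bullet> \<omega> m)))
       = ennreal (\<Prod>m<n. 1 + h \<bullet> \<omega> m) * ennreal ((norm (T \<omega> - h))\<^sup>2)"
      by (simp add: mult.commute)
  qed
  also have "\<dots> = (\<integral>\<^sup>+ \<omega>. ennreal ((norm (T \<omega> - h))\<^sup>2) \<partial>PiM {..<n} (\<lambda>_. tilt h))"
    unfolding M_def by (rule nn_integral_PiM_tilt[OF nn, symmetric]) measurable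
  also have "\<dots> \<le> risk H n \<rho> \<theta> est"
    unfolding risk_def q_law_eq_tilt \<theta>
  proof (intro nn_integral_mono ennreal_leI power_mono)
    fix \<omega>
    have "T \<omega> - h = transpose H *v (est \<omega> - \<theta>)"
      using \<theta>(2) by (simp add: T_def hth_eq matrix_vector_mult_diff_distrib)
    then show "norm (T \<omega> - h) \<le> norm (est \<omega> - \<theta>)"
      using norm_transpose_H_le by simp
  qed simp
  also have "\<dots> \<le> worst_risk H n \<rho> est"
    unfolding worst_risk_def by (rule SUP_upper[OF \<theta>(1)])
  finally show ?thesis unfolding T_def .
qed

text \<open>The worst case dominates the Bayes risk, and the coordinate bounds are added with a
  common \<open>c\<close>, because the budget controls the sum of the coordinate variances and not
  each of them.\<close>

lemma worst_risk_ge: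
  assumes r: "0 < r" and \<eta>: "\<eta> < 1" and r\<eta>: "dd * r * dd\<^sup>2 \<le> \<eta>"
    and est: "est \<in> estimators n"
    and chi: "chi_star H \<rho> \<le> ennreal C" and C: "0 \<le> C"
  shows "ennreal ((dd - 1)\<^sup>2 / (real n * (dd * (dd - 1) * C / (dd + 2 * sqrt (dd - 1))) / (1 - \<eta>) + 10 * (dd - 1) / r\<^sup>2))
    \<le> worst_risk H n \<rho> est"
proof -
  define \<tau> where "\<tau> = dd * (dd - 1) * C / (dd + 2 * sqrt (dd - 1))"
  define A where "A = real n * \<tau> / (1 - \<eta>) + 10 * (dd - 1) / r\<^sup>2"
  define S where "S k = (\<integral>x. (x $ k)\<^sup>2 \<partial>\<rho>)" for k
  define B where "B k = real n * S k / (1 - \<eta>) + 10 / r\<^sup>2" for k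
  \<comment> \<open>The maximiser of 2 c (d - 1) - c^2 \<open>A\<close>, with maximum (d - 1)^2 /
    \<open>A\<close>.\<close>
  define c where "c = (dd - 1) / A"
  define T where "T = (\<lambda>\<omega>. transpose H *v est \<omega>)"
  define W where "W = worst_risk H n \<rho> est"
  define P where "P = PiM UNIV (\<lambda>_::'m. prior r)"
  have \<tau>0: "0 \<le> \<tau>" using C dd3 by (simp add: \<tau>_def)
  have A: "0 < A" unfolding A_def using \<tau>0 \<eta> r dd3 by (intro add_nonneg_pos) auto
  have c: "0 \<le> c" using A dd3 by (simp add: c_def)
  interpret PP: prob_space P unfolding P_def by (intro prob_space_PiM prob_space_prior[OF r])
  have T: "T \<in> borel_measurable (PiM {..<n} (\<lambda>_. borel))"
    unfolding T_def by (rule transpose_estimator_measurable[OF est])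
  have S0: "0 \<le> S k" for k unfolding S_def by (rule Bochner_Integration.integral_nonneg) simp
  have S_le: "(\<Sum>k\<in>UNIV. S k) \<le> \<tau>"
  proof -
    have bd: "norm ((norm x)\<^sup>2) \<le> (dd\<^sup>2)\<^sup>2" if "x \<in> Xd H" for x
      using power_mono[OF Xd_norm_le[OF that], of 2] by simp
    have intn: "integrable \<rho> (\<lambda>x. (norm x)\<^sup>2)"
      by (rule integrable_bounded_Xd[OF _ bd]) simp
    have intk: "integrable \<rho> (\<lambda>x. (x $ k)\<^sup>2)" for k
    proof (rule Bochner_Integration.integrable_bound[OF intn])
      have "(x $ k)\<^sup>2 \<le> (norm x)\<^sup>2" for x :: "real^'m"
        using power_mono[OF component_le_norm_cart[of x k] abs_ge_zero, of 2] by simp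
      then show "AE x in \<rho>. norm ((x $ k)\<^sup>2) \<le> norm ((norm x)\<^sup>2)" by simp
    qed simp
    have "(\<Sum>k\<in>UNIV. S k) = (\<integral>x. (norm x)\<^sup>2 \<partial>\<rho>)"
      unfolding S_def power2_norm_vec using intk by simp
    moreover have "ennreal (\<integral>x. (norm x)\<^sup>2 \<partial>\<rho>) \<le> ennreal \<tau>"
      using anchored_second_moment_le[OF rho chi C] nn_integral_eq_integral[OF intn]
      by (simp add: \<tau>_def)
    ultimately show ?thesis using \<tau>0 by (simp add: ennreal_le_iff)
  qed
  have "ennreal (\<Sum>k\<in>(UNIV::'m set). 2 * c) = (\<Sum>k\<in>(UNIV::'m set). ennreal (2 * c))"
    using c by (intro sum_ennreal[symmetric]) auto
  also have "\<dots> \<le> (\<Sum>k\<in>UNIV. (\<integral>\<^sup>+ u. coord_risk n T k (clamp_vec r u) \<partial>P) + ennreal (c\<^sup>2 * B k))"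
    unfolding P_def B_def S_def by (intro sum_mono average_coord_risk_ge[OF r c \<eta> r\<eta> T])
  also have "\<dots> = (\<Sum>k\<in>UNIV. \<integral>\<^sup>+ u. coord_risk n T k (clamp_vec r u) \<partial>P) + ennreal (\<Sum>k\<in>UNIV. c\<^sup>2 * B k)"
    using S0 \<eta> by (subst sum_ennreal[symmetric]) (auto simp: sum.distrib B_def)
  also have "(\<Sum>k\<in>UNIV. \<integral>\<^sup>+ u. coord_risk n T k (clamp_vec r u) \<partial>P)
     = (\<integral>\<^sup>+ u. (\<Sum>k\<in>UNIV. coord_risk n T k (clamp_vec r u)) \<partial>P)"
  proof (rule nn_integral_sum[symmetric])
    show "(\<lambda>u. coord_risk n T k (clamp_vec r u)) \<in> borel_measurable P" for k
      by (rule coord_risk_measurable[OF T]) (simp add: clamp_vec_def P_def)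
  qed
  also have "\<dots> \<le> (\<integral>\<^sup>+ u. W \<partial>P)"
  proof (rule nn_integral_mono)
    fix u :: "'m \<Rightarrow> real"
    have n1: "norm (clamp_vec r u) \<le> dd * r"
      using norm_clamp_vec_le[of r u] r by (simp add: card_m algebra_simps)
    \<comment> \<open>This serves twice: it keeps the likelihood nonnegative on \<open>Xd H\<close>
      and, as d \<le> d^2, it keeps the lifted parameter inside the simplex.\<close>
    have "norm (clamp_vec r u) * dd\<^sup>2 \<le> 1"
      using mult_right_mono[OF n1, of "dd\<^sup>2"] r\<eta> \<eta> by simp
    moreover have "norm (clamp_vec r u) * dd \<le> norm (clamp_vec r u) * dd\<^sup>2"
      using dd3 by (intro mult_left_mono) (auto simp: power2_eq_square)
    ultimately have n2: "norm (clamp_vec r u) \<le> 1 / dd"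
      using dd3 by (simp add: field_simps)
    show "(\<Sum>k\<in>UNIV. coord_risk n T k (clamp_vec r u)) \<le> W"
      unfolding T_def W_def
    proof (rule sum_coord_risk_le[OF est n2])
      fix x assume x: "x \<in> Xd H"
      have "\<bar>clamp_vec r u \<bullet> x\<bar> \<le> norm (clamp_vec r u) * norm x"
        by (rule Cauchy_Schwarz_ineq2)
      also have "\<dots> \<le> norm (clamp_vec r u) * dd\<^sup>2"
        by (intro mult_left_mono Xd_norm_le[OF x]) simp
      also have "\<dots> \<le> 1" by fact
      finally show "0 \<le> 1 + clamp_vec r u \<bullet> x" by linarith
    qed
  qed
  also have "(\<integral>\<^sup>+ u. W \<partial>P) = W" by (simp add: PP.emeasure_space_1)
  finally have main: "ennreal (2 * c * (dd - 1)) \<le> W + ennreal (\<Sum>k\<in>UNIV. c\<^sup>2 * B k)"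
    by (simp add: card_m mult_ac add_right_mono)
  have "(\<Sum>k\<in>UNIV. B k) = real n * (\<Sum>k\<in>UNIV. S k) / (1 - \<eta>) + 10 * (dd - 1) / r\<^sup>2"
    by (simp add: B_def sum.distrib sum_distrib_left sum_divide_distrib card_m)
  also have "\<dots> \<le> A"
    unfolding A_def using S_le \<eta> by (intro add_right_mono divide_right_mono mult_left_mono) auto
  finally have BA: "(\<Sum>k\<in>UNIV. c\<^sup>2 * B k) \<le> c\<^sup>2 * A"
    by (simp add: sum_distrib_left[symmetric] mult_left_mono)
  have val: "2 * c * (dd - 1) - c\<^sup>2 * A = (dd - 1)\<^sup>2 / A"
    using A by (simp add: c_def power2_eq_square field_simps)
  have "ennreal (2 * c * (dd - 1)) \<le> W + ennreal (c\<^sup>2 * A)"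
    using main BA by (meson add_left_mono ennreal_leI order_trans)
  then have "ennreal (2 * c * (dd - 1)) - ennreal (c\<^sup>2 * A) \<le> W"
    by (simp add: ennreal_minus_le_iff add.commute)
  then have "ennreal (2 * c * (dd - 1) - c\<^sup>2 * A) \<le> W"
    using A by (subst ennreal_minus[symmetric]) auto
  then show ?thesis by (simp only: val) (simp only: A_def W_def \<tau>_def)
qed

end

section \<open>The two-level mixtures\<close>

lemma sum_option: "(\<Sum>z\<in>(UNIV :: 'a::finite option set). F z) = F None + (\<Sum>i\<in>UNIV. F (Some i))"
  by (simp add: UNIV_option_conv sum.reindex)

definition atom :: "real^'m^'d \<Rightarrow> real \<Rightarrow> 'd option \<Rightarrow> real^'m" where
  "atom H t z = (case z of None \<Rightarrow> 0 | Some i \<Rightarrow> t *\<^sub>R gam H i)"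

definition weight :: "real \<Rightarrow> 'd::finite option \<Rightarrow> real" where
  "weight p z = (case z of None \<Rightarrow> 1 - p | Some i \<Rightarrow> p / real CARD('d))"

text \<open>A push-forward of a finite point measure, with \<open>None\<close> indexing the atom at
  the origin: countable additivity comes for free and integrals become finite sums.\<close>

definition mixture :: "real^'m^'d \<Rightarrow> real \<Rightarrow> real \<Rightarrow> (real^'m) measure" where
  "mixture H p t = distr (point_measure UNIV (\<lambda>z. ennreal (weight p z))) borel (atom H t)"

lemma sets_mixture [simp, measurable_cong]: "sets (mixture H p t) = sets borel"
  by (simp add: mixture_def)

lemma space_mixture [simp]: "space (mixture H p t) = UNIV"
  by (simp add: mixture_def)

lemma weight_nonneg: "0 \<le> p \<Longrightarrow> p \<le> 1 \<Longrightarrow> 0 \<le> weight p z"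
  by (simp add: weight_def split: option.split)

lemma measurable_point_measure_UNIV [simp]: "f \<in> measurable (point_measure UNIV w) N \<longleftrightarrow> range f \<subseteq> space N"
  by (auto simp: point_measure_def measurable_def)

lemma nn_integral_mixture:
  fixes H :: "real^'m^'d"
  assumes "f \<in> borel_measurable borel"
  shows "integral\<^sup>N (mixture H p t) f
    = ennreal (1 - p) * f 0 + ennreal (p / real CARD('d)) * (\<Sum>i\<in>UNIV. f (t *\<^sub>R gam H i))"
  unfolding mixture_def using assms
  by (simp add: nn_integral_distr nn_integral_point_measure_finite sum_option weight_def atom_def sum_distrib_left)

lemma integral_mixture:
  fixes H :: "real^'m^'d" and f :: "_ \<Rightarrow> 'b::{banach, second_countable_topology}"
  assumes "f \<in> borel_measurable borel" "0 \<le> p" "p \<le> 1"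
  shows "integral\<^sup>L (mixture H p t) f
    = (1 - p) *\<^sub>R f 0 + (p / real CARD('d)) *\<^sub>R (\<Sum>i\<in>UNIV. f (t *\<^sub>R gam H i))"
proof -
  have "integral\<^sup>L (mixture H p t) f = (\<integral>z. f (atom H t z) \<partial>point_measure UNIV (\<lambda>z. ennreal (weight p z)))"
    unfolding mixture_def using assms(1) by (intro integral_distr) auto
  also have "\<dots> = (\<Sum>z\<in>UNIV. weight p z *\<^sub>R f (atom H t z))"
    using assms by (intro lebesgue_integral_point_measure_finite) (auto simp: weight_nonneg)
  also have "\<dots> = (1 - p) *\<^sub>R f 0 + (p / real CARD('d)) *\<^sub>R (\<Sum>i\<in>UNIV. f (t *\<^sub>R gam H i))"
    by (simp add: sum_option weight_def atom_def scaleR_sum_right)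
  finally show ?thesis .
qed

text \<open>\<open>measure_of\<close> returns the intended set function only if that function is a
  measure. Agreement with the emeasure of \<open>mixture\<close> on Borel sets settles this.\<close>

lemma rho_pl_eq_mixture:
  fixes H :: "real^'m^'d"
  shows "rho_pl H p lam = mixture H p (t_lam (real CARD('d)) lam)"
proof -
  let ?M = "mixture H p (t_lam (real CARD('d)) lam)"
  have "rho_pl H p lam = measure_of UNIV (sets borel) (emeasure ?M)"
    unfolding rho_pl_def
  proof (rule measure_of_eq)
    fix A :: "(real^'m) set" assume "A \<in> sigma_sets UNIV (sets borel)"
    then have A [measurable]: "A \<in> sets borel"
      using sets.sigma_sets_eq[of "borel :: (real^'m) measure"] by (simp only: space_borel)
    have "emeasure ?M A = (\<integral>\<^sup>+ x. indicator A x \<partial>?M)" by simp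
    also have "\<dots> = ennreal (1 - p) * indicator A 0
        + ennreal (p / real CARD('d)) * (\<Sum>i\<in>UNIV. indicator A (t_lam (real CARD('d)) lam *\<^sub>R gam H i))"
      by (rule nn_integral_mixture) measurable
    finally show "ennreal (1 - p) * indicator A 0
        + ennreal (p / real CARD('d)) * (\<Sum>i\<in>UNIV. indicator A (t_lam (real CARD('d)) lam *\<^sub>R gam H i)) = emeasure ?M A"
      by simp
  qed simp
  also have "\<dots> = ?M"
    using measure_of_of_measure[of ?M] by simp
  finally show ?thesis .
qed

context simplex_frame begin

lemma atom_Xd:
  assumes "0 \<le> t" "t \<le> dd"
  shows "t *\<^sub>R gam H i \<in> Xd H"
proof -
  have "0 \<le> 1 + t * (1 - 1 / dd)" using assms dd3 by simp
  moreover have "0 \<le> 1 - t / dd" using assms dd3 by simp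
  ultimately show ?thesis by (auto simp: Xd_def gam_inner_gam)
qed

lemma mixture_anchored:
  assumes p: "0 \<le> p" "p \<le> 1" and t: "0 \<le> t" "t \<le> dd"
  shows "mixture H p t \<in> anchored H"
proof -
  have "emeasure (mixture H p t) UNIV = (\<integral>\<^sup>+ x. 1 \<partial>mixture H p t)" by simp
  also have "\<dots> = ennreal (1 - p) + ennreal (p / dd) * of_nat CARD('d)"
    by (subst nn_integral_mixture) auto
  also have "\<dots> = ennreal ((1 - p) + p / dd * dd)"
    using p dd3 by (simp add: ennreal_of_nat_eq_real_of_nat ennreal_mult[symmetric] ennreal_plus[symmetric] del: ennreal_plus)
  also have "\<dots> = 1" using dd3 by simp
  finally have "prob_space (mixture H p t)" by (intro prob_spaceI) simp
  moreover have "AE x in mixture H p t. x \<in> Xd H"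
  proof -
    have "{x. \<forall>i. 0 \<le> 1 + gam H i \<bullet> x} \<in> sets borel" by measurable
    then have "{x. x \<in> Xd H} \<in> sets borel" by (simp add: Xd_def)
    moreover have "atom H t z \<in> Xd H" for z
      using atom_Xd[OF t] by (auto simp: atom_def Xd_def split: option.split)
    ultimately show ?thesis unfolding mixture_def by (subst AE_distr_iff) auto
  qed
  moreover have "(\<integral>x. x \<partial>mixture H p t) = 0"
    using p by (simp add: integral_mixture scaleR_sum_right[symmetric] sum_gam)
  ultimately show ?thesis by (simp add: anchored_def)
qed

text \<open>(\<open>gam H j\<close> - \<open>gam H i\<close>) \<bullet> \<open>gam H k\<close> is -1
  for k = i, 1 for k = j and 0 otherwise, so only two atoms contribute, with denominators 1 + t (1 -
  1/d) and 1 - t/d. The strict bound t < d keeps the second one positive.\<close>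

lemma chi_star_mixture_le:
  assumes p: "0 \<le> p" "p \<le> 1" and t: "0 \<le> t" "t < dd"
  shows "chi_star H (mixture H p t) \<le> ennreal (p / dd * (t\<^sup>2 / (1 + t * (1 - 1 / dd)) + t\<^sup>2 / (1 - t / dd)))"
  unfolding chi_star_def
proof (rule SUP_least)
  fix ij :: "'d \<times> 'd" assume "ij \<in> {(i, j). i \<noteq> j}"
  then obtain i j where ij: "ij = (i, j)" "i \<noteq> j" by auto
  define v where "v k = (if k = i then t\<^sup>2 / (1 + t * (1 - 1 / dd)) else 0) + (if k = j then t\<^sup>2 / (1 - t / dd) else 0)" for k
  have pos: "0 < 1 - t / dd" "0 < 1 + t * (1 - 1 / dd)"
    using t dd3 by (simp, intro add_pos_nonneg mult_nonneg_nonneg) simp_all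
  have v0: "0 \<le> v k" for k using pos by (simp add: v_def)
  have chi: "chi_integrand H i j (t *\<^sub>R gam H k) = ennreal (v k)" for k
    using pos ij(2)
    by (auto simp: chi_integrand_def Let_def gam_inner_gam inner_diff_left v_def algebra_simps)
  have "(\<integral>\<^sup>+ x. chi_integrand H (fst ij) (snd ij) x \<partial>mixture H p t)
      = ennreal (1 - p) * chi_integrand H i j 0 + ennreal (p / dd) * (\<Sum>k\<in>UNIV. ennreal (v k))"
    using ij by (simp add: nn_integral_mixture chi)
  also have "\<dots> = ennreal (p / dd * (\<Sum>k\<in>UNIV. v k))"
    using p v0 dd3 by (simp add: chi_integrand_def ennreal_mult[symmetric] sum_nonneg)
  also have "(\<Sum>k\<in>UNIV. v k) = t\<^sup>2 / (1 + t * (1 - 1 / dd)) + t\<^sup>2 / (1 - t / dd)"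
    by (simp add: v_def sum.distrib)
  finally show "(\<integral>\<^sup>+ x. chi_integrand H (fst ij) (snd ij) x \<partial>mixture H p t)
      \<le> ennreal (p / dd * (t\<^sup>2 / (1 + t * (1 - 1 / dd)) + t\<^sup>2 / (1 - t / dd)))" by simp
qed

lemma Sigma_mat_mixture:
  assumes p: "0 \<le> p" "p \<le> 1"
  shows "Sigma_mat (mixture H p t) = (p * t\<^sup>2 / dd) *\<^sub>R mat 1"
proof -
  have "(\<integral>x. x $ k * x $ l \<partial>mixture H p t) = p * t\<^sup>2 / dd * (if k = l then 1 else 0)" for k l
  proof -
    have "(\<integral>x. x $ k * x $ l \<partial>mixture H p t) = p / dd * (\<Sum>i\<in>UNIV. t\<^sup>2 * (H $ i $ k * H $ i $ l))"
      using p by (simp add: integral_mixture gam_nth power2_eq_square mult_ac)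
    then show ?thesis by (simp add: sum_distrib_left[symmetric] sum_col_col)
  qed
  then show ?thesis by (simp add: Sigma_mat_def vec_eq_iff mat_def)
qed

text \<open>All nonzero atoms have the same norm and the frame vectors sum to zero, so the
  third-moment term vanishes. The quadratic terms are evaluated by the Parseval identity
  \<open>sum_inner_gam_sq\<close>; the tilt contributes -2 |h|^2 against the +|h|^2 of the
  square.\<close>

lemma integral_mixture_sq_error:
  assumes p: "0 < p" "p \<le> 1" and t: "0 < t"
  defines "s \<equiv> p * t\<^sup>2 / dd"
  shows "(\<integral>x. (1 + h \<bullet> x) * (norm (x /\<^sub>R s - h))\<^sup>2 \<partial>mixture H p t) = (dd - 1) / s - (norm h)\<^sup>2"
proof -
  \<comment> \<open>The common squared norm of the rescaled atoms t \<open>gam H i\<close> /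
    s.\<close>
  define K where "K = t\<^sup>2 / s\<^sup>2 * (1 - 1 / dd)"
  have s: "0 < s" using p t dd3 by (simp add: s_def)
  have summand: "(1 + h \<bullet> (t *\<^sub>R gam H i)) * (norm ((t *\<^sub>R gam H i) /\<^sub>R s - h))\<^sup>2
     = (K + (norm h)\<^sup>2) + (t * K - 2 * t / s + t * (norm h)\<^sup>2) * (gam H i \<bullet> h) - 2 * t\<^sup>2 / s * (gam H i \<bullet> h)\<^sup>2" for i
  proof -
    have "(norm ((t *\<^sub>R gam H i) /\<^sub>R s - h))\<^sup>2 = K - 2 * t / s * (gam H i \<bullet> h) + (norm h)\<^sup>2"
    proof -
      have "(norm (c *\<^sub>R gam H i - h))\<^sup>2 = c\<^sup>2 * (1 - 1 / dd) - 2 * c * (gam H i \<bullet> h) + (norm h)\<^sup>2" for c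
        unfolding power2_norm_eq_inner
        by (simp add: inner_diff_left inner_diff_right gam_inner_gam inner_commute power2_eq_square)
      from this[of "t / s"] show ?thesis
        using s by (simp add: K_def power_divide inverse_eq_divide)
    qed
    then have "(1 + h \<bullet> (t *\<^sub>R gam H i)) * (norm ((t *\<^sub>R gam H i) /\<^sub>R s - h))\<^sup>2
       = (1 + t * (gam H i \<bullet> h)) * (K - 2 * t / s * (gam H i \<bullet> h) + (norm h)\<^sup>2)"
      by (simp add: inner_commute)
    also have "\<dots> = (K + (norm h)\<^sup>2) + (t * K - 2 * t / s + t * (norm h)\<^sup>2) * (gam H i \<bullet> h) - 2 * t\<^sup>2 / s * (gam H i \<bullet> h)\<^sup>2"
      by (simp add: algebra_simps power2_eq_square add_divide_distrib)
    finally show ?thesis .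
  qed
  have sum_atoms: "(\<Sum>i\<in>UNIV. (1 + h \<bullet> (t *\<^sub>R gam H i)) * (norm ((t *\<^sub>R gam H i) /\<^sub>R s - h))\<^sup>2)
      = dd * (K + (norm h)\<^sup>2) - 2 * t\<^sup>2 / s * (norm h)\<^sup>2"
    unfolding summand sum.distrib sum_subtractf sum_distrib_left[symmetric] sum_inner_gam sum_inner_gam_sq
    by (simp add: distrib_left)
  have "(\<integral>x. (1 + h \<bullet> x) * (norm (x /\<^sub>R s - h))\<^sup>2 \<partial>mixture H p t)
     = (1 - p) * (norm h)\<^sup>2 + p / dd * (dd * (K + (norm h)\<^sup>2) - 2 * t\<^sup>2 / s * (norm h)\<^sup>2)"
  proof (subst integral_mixture)
    show "(1 - p) *\<^sub>R ((1 + h \<bullet> 0) * (norm (0 /\<^sub>R s - h))\<^sup>2)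
        + (p / real CARD('d)) *\<^sub>R (\<Sum>i\<in>UNIV. (1 + h \<bullet> (t *\<^sub>R gam H i)) * (norm ((t *\<^sub>R gam H i) /\<^sub>R s - h))\<^sup>2)
      = (1 - p) * (norm h)\<^sup>2 + p / dd * (dd * (K + (norm h)\<^sup>2) - 2 * t\<^sup>2 / s * (norm h)\<^sup>2)"
      unfolding sum_atoms by simp
  qed (use p in auto)
  also have "\<dots> = p * K + (norm h)\<^sup>2 - 2 * (p * t\<^sup>2 / dd) / s * (norm h)\<^sup>2"
    using dd3 by (simp add: field_simps)
  also have "\<dots> = p * K - (norm h)\<^sup>2"
    using s by (simp add: s_def[symmetric])
  also have "p * K = (p * t\<^sup>2 / dd) * (dd - 1) / s\<^sup>2"
    using dd3 by (simp add: K_def field_simps)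
  also have "\<dots> = (dd - 1) / s"
    unfolding s_def[symmetric] using s by (simp add: power2_eq_square)
  finally show ?thesis .
qed

end

section \<open>Risk of the canonical estimator for isotropic second moments\<close>

context anchored_frame begin

lemma canon_est_isotropic:
  assumes s: "s \<noteq> 0" and Sigma: "Sigma_mat \<rho> = s *\<^sub>R mat 1"
  shows "canon_est H n \<rho> \<omega> = (\<chi> i. 1 / dd) + H *v ((1 / real n) *\<^sub>R (\<Sum>m<n. \<omega> m) /\<^sub>R s)"
proof -
  have "matrix_inv (s *\<^sub>R mat 1 :: real^'m^'m) = (1 / s) *\<^sub>R mat 1"
  proof -
    let ?M = "s *\<^sub>R mat 1 :: real^'m^'m"
    have "?M ** ((1 / s) *\<^sub>R mat 1) = mat 1" "((1 / s) *\<^sub>R mat 1) ** ?M = mat 1"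
      using s by (simp_all add: scalar_matrix_assoc[symmetric] matrix_scalar_ac)
    then have "\<exists>B. ?M ** B = mat 1 \<and> B ** ?M = mat 1" by blast
    from someI_ex[OF this] have "matrix_inv ?M ** ?M = mat 1"
      unfolding matrix_inv_def ..
    then have "s *\<^sub>R matrix_inv ?M = mat 1"
      by (simp add: scalar_matrix_assoc[symmetric] matrix_scalar_ac)
    then have "(1 / s) *\<^sub>R (s *\<^sub>R matrix_inv ?M) = (1 / s) *\<^sub>R mat 1" by simp
    then show ?thesis using s by simp
  qed
  then show ?thesis
    by (simp add: canon_est_def Sigma scaleR_matrix_vector_assoc[symmetric] inverse_eq_divide)
qed

lemma canon_est_estimator:
  assumes "s \<noteq> 0" "Sigma_mat \<rho> = s *\<^sub>R mat 1"
  shows "canon_est H n \<rho> \<in> estimators n"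
proof -
  have [measurable]: "(\<lambda>x. H *v x) \<in> borel_measurable borel"
    by (intro borel_measurable_continuous_onI linear_continuous_on matrix_vector_mul_bounded_linear)
  have "(\<lambda>\<omega>. (\<chi> i. 1 / dd) + H *v ((1 / real n) *\<^sub>R (\<Sum>m<n. \<omega> m) /\<^sub>R s)) \<in> borel_measurable (PiM {..<n} (\<lambda>_. borel))"
    by measurable
  then show ?thesis
    unfolding estimators_def canon_est_isotropic[OF assms, abs_def] by simp
qed

text \<open>Because \<open>H\<close> is an isometry, the error equals the norm of the sample mean of
  x / s - h. Under the tilt this variable is centred, the mean of x being \<Sigma> h = s h, so the
  n-sample risk is the one-sample second moment divided by n.\<close>

lemma risk_canon_est_isotropic:
  assumes s: "s \<noteq> 0" and Sigma: "Sigma_mat \<rho> = s *\<^sub>R mat 1" and \<theta>: "\<theta> \<in> prob_simplex" and n: "0 < n"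
  shows "risk H n \<rho> \<theta> (canon_est H n \<rho>)
    = ennreal ((\<integral>x. (1 + hth H \<theta> \<bullet> x) * (norm (x /\<^sub>R s - hth H \<theta>))\<^sup>2 \<partial>\<rho>) / real n)"
proof -
  define h where "h = hth H \<theta>"
  have nn: "0 \<le> 1 + h \<bullet> x" if "x \<in> Xd H" for x
    unfolding h_def using \<theta> that by (rule simplex_density_nonneg)
  define f where "f k x = (x $ k / s - h $ k) / real n" for k and x :: "real^'m"
  have [measurable]: "f k \<in> borel_measurable borel" for k unfolding f_def by measurable
  have nth_le: "\<bar>x $ k\<bar> \<le> dd\<^sup>2" if "x \<in> Xd H" for x k
    using component_le_norm_cart[of x k] Xd_norm_le[OF that] by simp
  have dens_le: "\<bar>1 + h \<bullet> x\<bar> \<le> 1 + norm h * dd\<^sup>2" if "x \<in> Xd H" for x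
  proof -
    have "\<bar>h \<bullet> x\<bar> \<le> norm h * norm x" by (rule Cauchy_Schwarz_ineq2)
    also have "\<dots> \<le> norm h * dd\<^sup>2" by (intro mult_left_mono Xd_norm_le that) simp
    finally show ?thesis by linarith
  qed
  define D where "D = (dd\<^sup>2 / \<bar>s\<bar> + norm h) / real n"
  have f_le: "\<bar>f k x\<bar> \<le> D" if "x \<in> Xd H" for x k
  proof -
    have "\<bar>x $ k / s - h $ k\<bar> \<le> \<bar>x $ k / s\<bar> + \<bar>h $ k\<bar>" by (rule abs_triangle_ineq4)
    also have "\<dots> \<le> dd\<^sup>2 / \<bar>s\<bar> + norm h"
      using nth_le[OF that, of k] component_le_norm_cart[of h k]
      by (intro add_mono) (auto simp: divide_right_mono)
    finally show ?thesis by (simp add: f_def D_def divide_right_mono)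
  qed
  have int1: "integrable \<rho> (\<lambda>x. (1 + h \<bullet> x) * f k x)" for k
  proof (rule integrable_bounded_Xd)
    fix x assume x: "x \<in> Xd H"
    show "norm ((1 + h \<bullet> x) * f k x) \<le> (1 + norm h * dd\<^sup>2) * D"
      using dens_le[OF x] f_le[OF x, of k] by (auto simp: abs_mult intro!: mult_mono)
  qed measurable
  have int2: "integrable \<rho> (\<lambda>x. (1 + h \<bullet> x) * (f k x)\<^sup>2)" for k
  proof (rule integrable_bounded_Xd)
    fix x assume x: "x \<in> Xd H"
    show "norm ((1 + h \<bullet> x) * (f k x)\<^sup>2) \<le> (1 + norm h * dd\<^sup>2) * D\<^sup>2"
      using dens_le[OF x] power_mono[OF f_le[OF x, of k] abs_ge_zero, of 2] by (auto simp: abs_mult intro!: mult_mono)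
  qed measurable
  have int_nth: "integrable \<rho> (\<lambda>x. x $ k)" "(\<integral>x. x $ k \<partial>\<rho>) = 0" for k
    using integrable_inner_rho[of "axis k 1"] integral_inner_rho[of "axis k 1"]
    by (simp_all add: inner_axis inner_commute[of "axis k 1"])
  have int_nn: "integrable \<rho> (\<lambda>x. x $ l * x $ k)" for k l
  proof (rule integrable_bounded_Xd)
    fix x assume x: "x \<in> Xd H"
    show "norm (x $ l * x $ k) \<le> dd\<^sup>2 * dd\<^sup>2"
      unfolding real_norm_def abs_mult by (intro mult_mono nth_le x) auto
  qed measurable
  have Sig: "(\<integral>x. x $ l * x $ k \<partial>\<rho>) = (if l = k then s else 0)" for k l
  proof -
    have "Sigma_mat \<rho> $ l $ k = (s *\<^sub>R mat 1 :: real^'m^'m) $ l $ k" by (simp add: Sigma)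
    then show ?thesis by (simp add: Sigma_mat_def mat_def)
  qed
  \<comment> \<open>Unbiasedness: the second-moment term contributes \<Sigma> h / s = h, which
    cancels the constant -h; the terms linear in x vanish by anchoring.\<close>
  have mean: "(\<integral>x. (1 + h \<bullet> x) * f k x \<partial>\<rho>) = 0" for k
  proof -
    have hx: "h \<bullet> x = (\<Sum>l\<in>UNIV. h $ l * x $ l)" for x by (simp add: inner_vec_def)
    have "(1 + h \<bullet> x) * f k x = (x $ k / s - h $ k - h $ k * (h \<bullet> x) + (\<Sum>l\<in>UNIV. h $ l / s * (x $ l * x $ k))) / real n" for x
    proof -
      have "(\<Sum>l\<in>UNIV. h $ l / s * (x $ l * x $ k)) = (h \<bullet> x) * (x $ k / s)"
        unfolding hx sum_distrib_right by (intro sum.cong) auto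
      then show ?thesis by (simp add: f_def algebra_simps add_divide_distrib diff_divide_distrib)
    qed
    then have "(\<integral>x. (1 + h \<bullet> x) * f k x \<partial>\<rho>)
       = (\<integral>x. (x $ k / s - h $ k - h $ k * (h \<bullet> x) + (\<Sum>l\<in>UNIV. h $ l / s * (x $ l * x $ k))) / real n \<partial>\<rho>)"
      by simp
    also have "\<dots> = (- h $ k + (\<Sum>l\<in>UNIV. h $ l / s * (if l = k then s else 0))) / real n"
      using int_nth int_nn integrable_inner_rho
      by (simp add: integral_inner_rho Sig prob_space[simplified])
    also have "\<dots> = 0" using s by (simp add: if_distrib cong: if_cong)
    finally show ?thesis .
  qed
  have "risk H n \<rho> \<theta> (canon_est H n \<rho>)
     = (\<integral>\<^sup>+ \<omega>. (\<Sum>k\<in>UNIV. ennreal ((0 + (\<Sum>m<n. f k (\<omega> m)))\<^sup>2)) \<partial>PiM {..<n} (\<lambda>_. tilt h))"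
    unfolding risk_def q_law_eq_tilt h_def[symmetric]
  proof (rule nn_integral_cong)
    fix \<omega> :: "nat \<Rightarrow> real^'m"
    have "canon_est H n \<rho> \<omega> - \<theta> = H *v ((1 / real n) *\<^sub>R (\<Sum>m<n. \<omega> m) /\<^sub>R s - h)"
      using H_hth[of \<theta>] \<theta> by (simp add: canon_est_isotropic[OF s Sigma] matrix_vector_mult_diff_distrib prob_simplex_def h_def)
    then have "(norm (canon_est H n \<rho> \<omega> - \<theta>))\<^sup>2 = (\<Sum>k\<in>UNIV. (((1 / real n) *\<^sub>R (\<Sum>m<n. \<omega> m) /\<^sub>R s - h) $ k)\<^sup>2)"
      by (simp only: norm_H power2_norm_vec)
    moreover have "((1 / real n) *\<^sub>R (\<Sum>m<n. \<omega> m) /\<^sub>R s - h) $ k = 0 + (\<Sum>m<n. f k (\<omega> m))" for k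
      using n s by (simp add: f_def sum_divide_distrib[symmetric] sum_subtractf field_simps)
    ultimately show "ennreal ((norm (canon_est H n \<rho> \<omega> - \<theta>))\<^sup>2) = (\<Sum>k\<in>UNIV. ennreal ((0 + (\<Sum>m<n. f k (\<omega> m)))\<^sup>2))"
      by (simp only: sum_ennreal[symmetric] zero_le_power2)
  qed
  also have "\<dots> = (\<Sum>k\<in>UNIV. \<integral>\<^sup>+ \<omega>. ennreal ((0 + (\<Sum>m<n. f k (\<omega> m)))\<^sup>2) \<partial>PiM {..<n} (\<lambda>_. tilt h))"
    by (rule nn_integral_sum) auto
  also have "\<dots> = (\<Sum>k\<in>UNIV. ennreal (0\<^sup>2 + real n * (\<integral>x. (f k x)\<^sup>2 \<partial>tilt h)))"
  proof (intro sum.cong refl nn_integral_PiM_sum_sq prob_space_tilt nn)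
    fix k
    show "integrable (tilt h) (f k)" using int1 by (simp add: integral_tilt[OF nn])
    show "integrable (tilt h) (\<lambda>x. (f k x)\<^sup>2)" using int2 by (simp add: integral_tilt[OF nn])
    show "(\<integral>x. f k x \<partial>tilt h) = 0" using mean by (simp add: integral_tilt[OF nn])
  qed auto
  also have "\<dots> = ennreal (\<Sum>k\<in>UNIV. real n * (\<integral>x. (f k x)\<^sup>2 \<partial>tilt h))"
    by (subst sum_ennreal) (auto intro!: mult_nonneg_nonneg Bochner_Integration.integral_nonneg)
  also have "(\<Sum>k\<in>UNIV. real n * (\<integral>x. (f k x)\<^sup>2 \<partial>tilt h)) = real n * (\<integral>x. (\<Sum>k\<in>UNIV. (1 + h \<bullet> x) * (f k x)\<^sup>2) \<partial>\<rho>)"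
    using int2 by (simp add: integral_tilt[OF nn] sum_distrib_left)
  also have "(\<lambda>x. \<Sum>k\<in>UNIV. (1 + h \<bullet> x) * (f k x)\<^sup>2) = (\<lambda>x. (1 + h \<bullet> x) * (norm (x /\<^sub>R s - h))\<^sup>2 / (real n)\<^sup>2)"
    by (simp add: power2_norm_vec f_def power_divide sum_distrib_left sum_divide_distrib inverse_eq_divide)
  also have "real n * (\<integral>x. (1 + h \<bullet> x) * (norm (x /\<^sub>R s - h))\<^sup>2 / (real n)\<^sup>2 \<partial>\<rho>)
     = (\<integral>x. (1 + h \<bullet> x) * (norm (x /\<^sub>R s - h))\<^sup>2 \<partial>\<rho>) / real n"
    using n by (simp add: power2_eq_square)
  finally show ?thesis by (simp add: h_def)
qed

end

context simplex_frame begin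

lemma worst_risk_mixture:
  assumes p: "0 < p" "p \<le> 1" and t: "0 < t" "t \<le> dd" and n: "0 < n"
  defines "s \<equiv> p * t\<^sup>2 / dd"
  shows "canon_est H n (mixture H p t) \<in> estimators n"
    and "worst_risk H n (mixture H p t) (canon_est H n (mixture H p t)) = ennreal ((dd - 1) / s / real n)"
proof -
  have s: "0 < s" using p t dd3 by (simp add: s_def)
  interpret anchored_frame H dd "mixture H p t"
    by unfold_locales (use p t in \<open>auto intro: mixture_anchored\<close>)
  have Sigma: "Sigma_mat (mixture H p t) = s *\<^sub>R mat 1"
    using p by (simp add: Sigma_mat_mixture s_def)
  show "canon_est H n (mixture H p t) \<in> estimators n"
    using canon_est_estimator[OF _ Sigma] s by simp
  have risk: "risk H n (mixture H p t) \<theta> (canon_est H n (mixture H p t))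
      = ennreal (((dd - 1) / s - (norm (hth H \<theta>))\<^sup>2) / real n)" if "\<theta> \<in> prob_simplex" for \<theta>
    using risk_canon_est_isotropic[OF _ Sigma that n] s p t integral_mixture_sq_error[of p t "hth H \<theta>", folded s_def] by simp
  show "worst_risk H n (mixture H p t) (canon_est H n (mixture H p t)) = ennreal ((dd - 1) / s / real n)"
    unfolding worst_risk_def
  proof (rule antisym)
    show "(SUP \<theta>\<in>prob_simplex. risk H n (mixture H p t) \<theta> (canon_est H n (mixture H p t))) \<le> ennreal ((dd - 1) / s / real n)"
    proof (rule SUP_least)
      fix \<theta> :: "real^'d" assume "\<theta> \<in> prob_simplex"
      then show "risk H n (mixture H p t) \<theta> (canon_est H n (mixture H p t)) \<le> ennreal ((dd - 1) / s / real n)"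
        by (simp only: risk) (intro ennreal_leI divide_right_mono, simp_all)
    qed
    \<comment> \<open>The uniform \<theta>, written as a lift so that \<open>hth_lift\<close> gives
      h = 0, where the risk is largest.\<close>
    have u: "(\<chi> i. 1 / dd) + H *v 0 \<in> prob_simplex"
      using dd3 by (intro lift_simplex) simp
    have "ennreal ((dd - 1) / s / real n) = risk H n (mixture H p t) ((\<chi> i. 1 / dd) + H *v 0) (canon_est H n (mixture H p t))"
      unfolding risk[OF u] hth_lift by simp
    also have "\<dots> \<le> (SUP \<theta>\<in>prob_simplex. risk H n (mixture H p t) \<theta> (canon_est H n (mixture H p t)))"
      by (rule SUP_upper[OF u])
    finally show "ennreal ((dd - 1) / s / real n) \<le> (SUP \<theta>\<in>prob_simplex. risk H n (mixture H p t) \<theta> (canon_est H n (mixture H p t)))" .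
  qed
qed

end

section \<open>Asymptotics\<close>

text \<open>With l = sqrt(d - 1) one has d = l^2 + 1 and d + l - 1 = l (l + 1), so
  \<open>C_star\<close> collapses to ((l - 1) / l)^2, which is the budget spent at p = 1. The last
  two claims say that \<open>p\<close> spends exactly \<open>C\<close> and that the resulting
  isotropic variance meets the second-moment bound.\<close>

lemma lam_star_identities:
  fixes d C :: real
  assumes d: "3 \<le> d" and C: "0 < C"
  defines "p \<equiv> C / C_star d" and "t \<equiv> t_lam d (lam_star d)"
  shows "0 < C_star d" "0 < p" "0 < t" "t < d"
    and "p / d * (t\<^sup>2 / (1 + t * (1 - 1 / d)) + t\<^sup>2 / (1 - t / d)) = C"
    and "(d - 1) / (p * t\<^sup>2 / d) = (d - 1) / d * ((d + 2 * sqrt (d - 1)) / C)"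
proof -
  define l where "l = lam_star d"
  have l2: "d = l\<^sup>2 + 1" using d by (simp add: l_def lam_star_def)
  have l1: "1 < l" using d by (simp add: l_def lam_star_def)
  have sq: "sqrt (d - 1) = l" by (simp add: l_def lam_star_def)
  have lp: "0 < l" "0 < l + 1" "0 < l - 1" "0 < l\<^sup>2 + 1" using l1 by (auto intro: add_pos_pos)
  have den: "d + l - 1 = l * (l + 1)" by (simp add: l2 power2_eq_square algebra_simps)
  have Cs: "C_star d = ((l - 1) / l)\<^sup>2"
    unfolding C_star_def l_def[symmetric] den using lp by (simp add: power2_eq_square)
  \<comment> \<open>At the atom t \<gamma>_i the value 1 + \<gamma>_j \<bullet> x is w for j
    \<noteq> i and l w for j = i, as \<open>td\<close> and \<open>td'\<close> show: the equality
    ratio of the pointwise inequality.\<close>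
  define w where "w = d / (l * (l + 1))"
  have d0: "0 < d" using d by simp
  have w: "0 < w" using lp d0 by (simp add: w_def)
  have t: "t = w * (l - 1)"
    unfolding t_def t_lam_def l_def[symmetric] den by (simp add: w_def)
  show Cs0: "0 < C_star d" using lp by (simp add: Cs)
  then show "0 < p" using C by (simp add: p_def)
  show "0 < t" unfolding t using lp w by simp
  have td: "1 - t / d = w"
  proof -
    have "t / d = (l - 1) / (l * (l + 1))" using d0 by (simp add: t w_def)
    moreover have "w = (l\<^sup>2 + 1) / (l * (l + 1))" by (simp only: w_def l2)
    moreover have "1 - (l - 1) / (l * (l + 1)) = (l\<^sup>2 + 1) / (l * (l + 1))"
      using lp by (simp add: field_simps power2_eq_square)
    ultimately show ?thesis by simp
  qed
  then have "t / d < 1" using w by linarith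
  then show "t < d" using d0 by simp
  have td': "1 + t * (1 - 1 / d) = l * w"
  proof -
    have "1 + t * (1 - 1 / d) = t + (1 - t / d)" by (simp add: right_diff_distrib)
    then show ?thesis unfolding td by (simp add: t algebra_simps)
  qed
  have pC: "p * (l - 1)\<^sup>2 = C * l\<^sup>2"
    unfolding p_def Cs using lp by (simp add: power_divide)
  have "p / d * (t\<^sup>2 / (1 + t * (1 - 1 / d)) + t\<^sup>2 / (1 - t / d)) = p * (l - 1)\<^sup>2 / l\<^sup>2"
  proof -
    have "t\<^sup>2 / (l * w) + t\<^sup>2 / w = w * (l - 1)\<^sup>2 * (l + 1) / l"
      unfolding t using w lp by (simp add: field_simps power2_eq_square)
    moreover have "w * (l + 1) = d / l" using lp by (simp add: w_def)
    ultimately have "t\<^sup>2 / (l * w) + t\<^sup>2 / w = (d / l) * (l - 1)\<^sup>2 / l"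
      by (metis (no_types, opaque_lifting) mult.assoc mult.commute)
    then show ?thesis unfolding td td' using d0 lp by (simp add: power2_eq_square)
  qed
  also have "\<dots> = C" using pC lp by simp
  finally show "p / d * (t\<^sup>2 / (1 + t * (1 - 1 / d)) + t\<^sup>2 / (1 - t / d)) = C" .
  have "p * t\<^sup>2 / d = (p * (l - 1)\<^sup>2) * d / (l\<^sup>2 * (l + 1)\<^sup>2)"
    unfolding t w_def using d0 by (simp add: power_mult_distrib power_divide power2_eq_square[of d])
  also have "\<dots> = C * d / (l + 1)\<^sup>2"
    unfolding pC using lp by simp
  also have "(l + 1)\<^sup>2 = d + 2 * sqrt (d - 1)"
    unfolding sq by (simp add: l2 power2_eq_square algebra_simps)
  finally show "(d - 1) / (p * t\<^sup>2 / d) = (d - 1) / d * ((d + 2 * sqrt (d - 1)) / C)"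
    by simp
qed

context simplex_frame begin

definition efficient_risk :: "nat \<Rightarrow> real \<Rightarrow> real" where
  "efficient_risk n C = (dd - 1) / (real n * dd) * ((dd + 2 * sqrt (dd - 1)) / C)"

lemma efficient_risk_attained:
  assumes C: "0 < C" "C \<le> C_star dd" and n: "0 < n"
  defines "\<rho> \<equiv> rho_pl H (C / C_star dd) (lam_star dd)"
  shows "\<rho> \<in> anchored H" "chi_star H \<rho> \<le> ennreal C" "canon_est H n \<rho> \<in> estimators n"
    "worst_risk H n \<rho> (canon_est H n \<rho>) = ennreal (efficient_risk n C)"
proof -
  define p where "p = C / C_star dd"
  define t where "t = t_lam dd (lam_star dd)"
  note id = lam_star_identities[OF dd3 C(1), folded p_def t_def]
  have p1: "p \<le> 1" using C id(1) by (simp add: p_def)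
  have \<rho>: "\<rho> = mixture H p t"
    by (simp add: \<rho>_def rho_pl_eq_mixture p_def t_def)
  show "\<rho> \<in> anchored H"
    unfolding \<rho> using id p1 by (intro mixture_anchored) auto
  show "chi_star H \<rho> \<le> ennreal C"
    unfolding \<rho> using chi_star_mixture_le[of p t] id p1 by simp
  show "canon_est H n \<rho> \<in> estimators n"
    unfolding \<rho> using id p1 n by (intro worst_risk_mixture) auto
  have "worst_risk H n \<rho> (canon_est H n \<rho>) = ennreal ((dd - 1) / (p * t\<^sup>2 / dd) / real n)"
    unfolding \<rho> using id p1 n by (intro worst_risk_mixture) auto
  then show "worst_risk H n \<rho> (canon_est H n \<rho>) = ennreal (efficient_risk n C)"
    unfolding id(6) by (simp add: efficient_risk_def mult_ac)
qed

lemma minimax_le: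
  assumes "0 < C" "C \<le> C_star dd" "0 < n"
  shows "minimax H n C \<le> ennreal (efficient_risk n C)"
proof -
  define \<rho> where "\<rho> = rho_pl H (C / C_star dd) (lam_star dd)"
  note att = efficient_risk_attained[OF assms, folded \<rho>_def]
  have "minimax H n C \<le> (INF est\<in>estimators n. worst_risk H n \<rho> est)"
    unfolding minimax_def using att(1,2) by (intro INF_lower) simp
  also have "\<dots> \<le> worst_risk H n \<rho> (canon_est H n \<rho>)"
    using att(3) by (rule INF_lower)
  finally show ?thesis using att(4) by simp
qed

text \<open>The factor by which the lower bound falls short of \<open>efficient_risk\<close>, in
  terms of y = n C and with r = y^(-1/4). The term 1 / (1 - d^3 r) is the inflation of the Fisher
  information over the cube; the other is the prior information relative to that of the
  data.\<close>

definition efficiency_loss :: "real \<Rightarrow> real" where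
  "efficiency_loss y = 1 / (1 / (1 - dd ^ 3 * y powr (- 1 / 4)) + 10 * (dd + 2 * sqrt (dd - 1)) / dd * y powr (- 1 / 2))"

lemma efficiency_loss_tendsto: "(efficiency_loss \<longlongrightarrow> 1) at_top"
proof -
  have lim: "((\<lambda>y. 1 / (1 / (1 - a * y powr (- 1 / 4)) + b * y powr (- 1 / 2))) \<longlongrightarrow> 1 / (1 / (1 - a * 0) + b * 0)) at_top" for a b :: real
    by (intro tendsto_intros tendsto_neg_powr filterlim_ident) auto
  show ?thesis
    using lim[of "dd ^ 3" "10 * (dd + 2 * sqrt (dd - 1)) / dd"] by (simp only: efficiency_loss_def[abs_def]) simp
qed

lemma minimax_ge:
  assumes C: "0 < C" and n: "0 < n" and small: "dd ^ 3 * (real n * C) powr (- 1 / 4) < 1"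
  shows "ennreal (efficient_risk n C * efficiency_loss (real n * C)) \<le> minimax H n C"
  unfolding minimax_def
proof (intro INF_greatest)
  fix \<rho> est assume \<rho>: "\<rho> \<in> {\<rho> \<in> anchored H. chi_star H \<rho> \<le> ennreal C}" and est: "est \<in> (estimators n :: ((nat \<Rightarrow> real^'m) \<Rightarrow> real^'d) set)"
  interpret anchored_frame H dd \<rho> by unfold_locales (use \<rho> in simp)
  define y where "y = real n * C"
  define r where "r = y powr (- 1 / 4)"
  define \<eta> where "\<eta> = dd ^ 3 * r"
  define \<kappa> where "\<kappa> = dd + 2 * sqrt (dd - 1)"
  have y: "0 < y" using C n by (simp add: y_def)
  have r: "0 < r" using y by (simp add: r_def)
  have \<eta>: "\<eta> < 1" using small by (simp add: \<eta>_def r_def y_def)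
  have \<kappa>: "0 < \<kappa>" using dd3 by (simp add: \<kappa>_def add_pos_nonneg)
  have r2: "r\<^sup>2 = y powr (- 1 / 2)"
    using y by (simp add: r_def power2_eq_square powr_add[symmetric])
  \<comment> \<open>So 1 / r^2 = y r^2: the prior term is of order sqrt(y), and the data term y
    factors out of \<open>D\<close>.\<close>
  have r4: "r\<^sup>2 * r\<^sup>2 * y = 1"
    using y by (simp add: r2 powr_add[symmetric] powr_minus_divide)
  define D where "D = real n * (dd * (dd - 1) * C / \<kappa>) / (1 - \<eta>) + 10 * (dd - 1) / r\<^sup>2"
  have D: "D = y * dd * (dd - 1) / \<kappa> * (1 / (1 - \<eta>) + 10 * \<kappa> / dd * r\<^sup>2)"
  proof -
    have "1 / r\<^sup>2 = y * r\<^sup>2" using r4 r by (simp add: field_simps)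
    then have "10 * (dd - 1) / r\<^sup>2 = 10 * (dd - 1) * (y * r\<^sup>2)"
      by (metis mult.right_neutral times_divide_eq_right)
    also have "\<dots> = y * dd * (dd - 1) / \<kappa> * (10 * \<kappa> / dd * r\<^sup>2)"
      using \<kappa> dd3 by simp
    finally have "10 * (dd - 1) / r\<^sup>2 = y * dd * (dd - 1) / \<kappa> * (10 * \<kappa> / dd * r\<^sup>2)" .
    then show ?thesis unfolding D_def by (simp add: y_def distrib_left mult_ac)
  qed
  have "(dd - 1)\<^sup>2 / D = efficient_risk n C * efficiency_loss (real n * C)"
  proof -
    define z where "z = 1 / (1 - \<eta>) + 10 * \<kappa> / dd * r\<^sup>2"
    have z: "0 < z" unfolding z_def using \<eta> \<kappa> dd3 by (intro add_pos_nonneg) auto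
    have "efficiency_loss (real n * C) = 1 / z"
      unfolding efficiency_loss_def z_def r2 \<eta>_def \<kappa>_def unfolding r_def y_def ..
    moreover have "efficient_risk n C = (dd - 1) * \<kappa> / (y * dd)"
      by (simp add: efficient_risk_def \<kappa>_def y_def mult_ac)
    ultimately show ?thesis
      unfolding D z_def[symmetric] using z y \<kappa> dd3 by (simp add: power2_eq_square)
  qed
  moreover have "ennreal ((dd - 1)\<^sup>2 / D) \<le> worst_risk H n \<rho> est"
    unfolding D_def \<kappa>_def
    by (rule worst_risk_ge[OF r \<eta> _ est]) (use \<rho> C in \<open>auto simp: \<eta>_def power3_eq_cube power2_eq_square mult_ac\<close>)
  ultimately show "ennreal (efficient_risk n C * efficiency_loss (real n * C)) \<le> worst_risk H n \<rho> est"
    by simp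
qed

text \<open>A sandwich between \<open>minimax_ge\<close> and \<open>minimax_le\<close>; the latter
  needs C n \<le> \<open>C_star dd\<close>, so that the mixing weight p is at most 1.\<close>

lemma minimax_asymptotics:
  assumes C: "\<And>n. 0 < C n" and C0: "C \<longlonglongrightarrow> 0" and nC: "filterlim (\<lambda>n. real n * C n) at_top sequentially"
  shows "\<exists>\<epsilon>. \<epsilon> \<longlonglongrightarrow> 0 \<and> (\<forall>\<^sub>F n in sequentially. minimax H n (C n) = ennreal (efficient_risk n (C n) * (1 + \<epsilon> n)))"
    and "\<forall>\<^sub>F n in sequentially. C n \<le> C_star dd"
proof -
  have "0 < C_star dd" using lam_star_identities(1)[OF dd3 zero_less_one] .
  then show small: "\<forall>\<^sub>F n in sequentially. C n \<le> C_star dd"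
    using order_tendstoD(2)[OF C0, of "C_star dd"] by (auto elim: eventually_mono)
  define \<epsilon> where "\<epsilon> n = enn2real (minimax H n (C n)) / efficient_risk n (C n) - 1" for n
  have "((\<lambda>y. dd ^ 3 * y powr (- 1 / 4)) \<longlongrightarrow> dd ^ 3 * 0) at_top"
    by (intro tendsto_intros tendsto_neg_powr filterlim_ident) auto
  then have "\<forall>\<^sub>F y in at_top. dd ^ 3 * y powr (- 1 / 4) < 1"
    by (intro order_tendstoD(2)[where a = 1]) auto
  then have ev: "\<forall>\<^sub>F n in sequentially. dd ^ 3 * (real n * C n) powr (- 1 / 4) < 1"
    using nC by (rule eventually_compose_filterlim)
  have bounds: "\<forall>\<^sub>F n in sequentially. efficiency_loss (real n * C n) - 1 \<le> \<epsilon> n \<and> \<epsilon> n \<le> 0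
      \<and> minimax H n (C n) = ennreal (efficient_risk n (C n) * (1 + \<epsilon> n))"
    using small ev eventually_gt_at_top[of 0]
  proof eventually_elim
    case (elim n)
    define U where "U = efficient_risk n (C n)"
    have U: "0 < U"
      unfolding U_def efficient_risk_def using elim(3) C[of n] dd3
      by (intro mult_pos_pos divide_pos_pos add_pos_nonneg) auto
    have up: "minimax H n (C n) \<le> ennreal U"
      unfolding U_def using C elim by (intro minimax_le) auto
    have lo: "ennreal (U * efficiency_loss (real n * C n)) \<le> minimax H n (C n)"
      unfolding U_def using C elim by (intro minimax_ge) auto
    \<comment> \<open>Finiteness, taken from the upper bound, is what allows \<epsilon> to be
      defined through \<open>enn2real\<close> without changing the value.\<close>
    have fin: "minimax H n (C n) < \<top>" using up by (rule order_le_less_trans) simp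
    have eq: "minimax H n (C n) = ennreal (enn2real (minimax H n (C n)))" using fin by simp
    have "U * efficiency_loss (real n * C n) \<le> enn2real (minimax H n (C n))"
      using lo by (subst (asm) eq) (simp add: ennreal_le_iff)
    moreover have "enn2real (minimax H n (C n)) \<le> U"
      using up U by (subst (asm) eq) (simp add: ennreal_le_iff)
    ultimately show ?case
      using U eq by (simp add: \<epsilon>_def U_def[symmetric] field_simps)
  qed
  have "(\<lambda>n. efficiency_loss (real n * C n) - 1) \<longlonglongrightarrow> 1 - 1"
    by (intro tendsto_diff filterlim_compose[OF efficiency_loss_tendsto nC] tendsto_const)
  then have lim: "(\<lambda>n. efficiency_loss (real n * C n) - 1) \<longlonglongrightarrow> 0" by simp
  have lower: "\<forall>\<^sub>F n in sequentially. efficiency_loss (real n * C n) - 1 \<le> \<epsilon> n"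
    and upper: "\<forall>\<^sub>F n in sequentially. \<epsilon> n \<le> 0"
    and eq: "\<forall>\<^sub>F n in sequentially. minimax H n (C n) = ennreal (efficient_risk n (C n) * (1 + \<epsilon> n))"
    using bounds by (eventually_elim, blast)+
  have "\<epsilon> \<longlonglongrightarrow> 0"
    by (rule tendsto_sandwich[OF lower upper lim tendsto_const])
  then show "\<exists>\<epsilon>. \<epsilon> \<longlonglongrightarrow> 0 \<and> (\<forall>\<^sub>F n in sequentially. minimax H n (C n) = ennreal (efficient_risk n (C n) * (1 + \<epsilon> n)))"
    using eq by blast
qed

end

theorem theorem8p1:
  fixes H :: "real^'m^'d" and C :: "nat \<Rightarrow> real"
  assumes "CARD('d) \<ge> 3" and "CARD('m) = CARD('d) - 1"
    and "transpose H ** H = mat 1" and "transpose H *v (\<chi> i. 1) = 0"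
    and "\<forall>n. 0 < C n" and "decseq C" and "C \<longlonglongrightarrow> 0"
    and "filterlim (\<lambda>n. real n * C n) at_top sequentially"
  shows "(\<exists>\<epsilon>. \<epsilon> \<longlonglongrightarrow> 0 \<and>
            (\<forall>\<^sub>F n in sequentially. minimax H n (C n)
               = ennreal ((real CARD('d) - 1) / (real n * real CARD('d))
                          * ((real CARD('d) + 2 * sqrt (real CARD('d) - 1)) / C n) * (1 + \<epsilon> n))))
       \<and> (\<forall>\<^sub>F n in sequentially.
            rho_pl H (C n / C_star (real CARD('d))) (lam_star (real CARD('d))) \<in> anchored H
          \<and> chi_star H (rho_pl H (C n / C_star (real CARD('d))) (lam_star (real CARD('d)))) \<le> ennreal (C n)
          \<and> canon_est H n (rho_pl H (C n / C_star (real CARD('d))) (lam_star (real CARD('d)))) \<in> estimators n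
          \<and> worst_risk H n (rho_pl H (C n / C_star (real CARD('d))) (lam_star (real CARD('d))))
               (canon_est H n (rho_pl H (C n / C_star (real CARD('d))) (lam_star (real CARD('d)))))
             = ennreal ((real CARD('d) - 1) / (real n * real CARD('d))
                          * ((real CARD('d) + 2 * sqrt (real CARD('d) - 1)) / C n)))"
proof -
  interpret simplex_frame H "real CARD('d)"
    using assms by unfold_locales auto
  note asym = minimax_asymptotics[of C, OF spec[OF assms(5)] assms(7,8)]
  have "\<forall>\<^sub>F n in sequentially.
            rho_pl H (C n / C_star (real CARD('d))) (lam_star (real CARD('d))) \<in> anchored H
          \<and> chi_star H (rho_pl H (C n / C_star (real CARD('d))) (lam_star (real CARD('d)))) \<le> ennreal (C n)
          \<and> canon_est H n (rho_pl H (C n / C_star (real CARD('d))) (lam_star (real CARD('d)))) \<in> estimators n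
          \<and> worst_risk H n (rho_pl H (C n / C_star (real CARD('d))) (lam_star (real CARD('d))))
               (canon_est H n (rho_pl H (C n / C_star (real CARD('d))) (lam_star (real CARD('d)))))
             = ennreal (efficient_risk n (C n))"
    using asym(2) eventually_gt_at_top[of 0]
  proof eventually_elim
    case (elim n)
    then show ?case
      using efficient_risk_attained[of "C n" n] assms(5) by blast
  qed
  with asym(1) show ?thesis unfolding efficient_risk_def by blast
qed

end
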